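(* Let $F$ be a graph and let $e$ be any edge of $F$. Then $\mathrm{th}(F)\le R(K_{\chi(F)},F\setminus e)$.
   Context: A hypergraph $\mathcal{H}$ is a Berge copy of a graph $G$ (Berge-$G$) if $V(G)\subseteq V(\mathcal{H})$ and there is a bijection $f:E(G)\to E(\mathcal{H})$ with $e\subseteq f(e)$ for every $e\in E(G)$; $G$ is then called the core. $\mathrm{ex}_r(n,\text{Berge-}F)$ denotes the maximum number of hyperedges in an $r$-uniform $n$-vertex hypergraph containing no Berge copy of $F$. It is known that for every graph $F$ there is an integer $r_0$ such that $\mathrm{ex}_r(n,\text{Berge-}F)=o(n^2)$ (as $n\to\infty$) for every $r\ge r_0$; the uniformity threshold $\mathrm{th}(F)$ is the smallest such $r_0$. $\chi(F)$ is the chromatic number, $F\setminus e$ is the graph obtained from $F$ by deleting the edge $e$, and $R(H,G)$ is the off-diagonal Ramsey number: the smallest $N$ such that every red/blue coloring of the edges of $K_N$ contains a blue copy of $H$ or a red copy of $G$. *)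

theory Defs
  imports Main "HOL-Library.Landau_Symbols"
begin

definition graph :: "'a set \<Rightarrow> 'a set set \<Rightarrow> bool" where
  "graph V E \<longleftrightarrow> finite V \<and> (\<forall>e\<in>E. e \<subseteq> V \<and> card e = 2)"

definition chromatic_number :: "'a set \<Rightarrow> 'a set set \<Rightarrow> nat" where
  "chromatic_number V E = (LEAST k. \<exists>c. c ` V \<subseteq> {0..<k} \<and>
      (\<forall>e\<in>E. \<forall>u\<in>e. \<forall>v\<in>e. u \<noteq> v \<longrightarrow> c u \<noteq> c v))"

definition complete_graph_edges :: "nat \<Rightarrow> nat set set" where
  "complete_graph_edges k = {e. e \<subseteq> {0..<k} \<and> card e = 2}"

text \<open>A red/blue colouring of the edges of K_N is a function col on 2-subsets of
  {0..<N}; col e = True means red, False means blue. A copy of the graph (V,E) in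
  colour b is an injective embedding of V into {0..<N} mapping every edge to an
  edge of colour b.\<close>
definition coloured_copy :: "nat \<Rightarrow> (nat set \<Rightarrow> bool) \<Rightarrow> bool \<Rightarrow> 'a set \<Rightarrow> 'a set set \<Rightarrow> bool" where
  "coloured_copy N col b V E \<longleftrightarrow> (\<exists>\<phi>. inj_on \<phi> V \<and> \<phi> ` V \<subseteq> {0..<N} \<and>
      (\<forall>e\<in>E. col (\<phi> ` e) = b))"

definition ramsey_number :: "'a set \<Rightarrow> 'a set set \<Rightarrow> 'b set \<Rightarrow> 'b set set \<Rightarrow> nat" where
  "ramsey_number VH EH VG EG = (LEAST N. \<forall>col :: nat set \<Rightarrow> bool.
      coloured_copy N col False VH EH \<or> coloured_copy N col True VG EG)"

definition uniform_hypergraph :: "nat \<Rightarrow> nat \<Rightarrow> nat set set \<Rightarrow> bool" where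
  "uniform_hypergraph r n H \<longleftrightarrow> (\<forall>h\<in>H. h \<subseteq> {0..<n} \<and> card h = r)"

definition contains_berge :: "'a set \<Rightarrow> 'a set set \<Rightarrow> nat \<Rightarrow> nat set set \<Rightarrow> bool" where
  "contains_berge V E n H \<longleftrightarrow> (\<exists>\<phi> f. inj_on \<phi> V \<and> \<phi> ` V \<subseteq> {0..<n} \<and>
      inj_on f E \<and> f ` E \<subseteq> H \<and> (\<forall>e\<in>E. \<phi> ` e \<subseteq> f e))"

definition ex_berge :: "nat \<Rightarrow> nat \<Rightarrow> 'a set \<Rightarrow> 'a set set \<Rightarrow> nat" where
  "ex_berge r n V E = Max {card H | H. uniform_hypergraph r n H \<and> \<not> contains_berge V E n H}"

definition uniformity_threshold :: "'a set \<Rightarrow> 'a set set \<Rightarrow> nat" where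
  "uniformity_threshold V E = (LEAST r0. \<forall>r\<ge>r0.
      (\<lambda>n. real (ex_berge r n V E)) \<in> o(\<lambda>n. real n ^ 2))"

end

theory Submission
  imports Defs "HOL-Library.Ramsey" "HOL-Library.Indicator_Function"
begin

text \<open>
  Let \<open>k = \<chi>(F)\<close> and let \<open>H\<close> be a Berge-\<open>F\<close>-free \<open>r\<close>-uniform hypergraph with
  \<open>r \<ge> R(K\<^sub>k, F - e)\<close>. Call a pair of vertices red if at least \<open>|E(F)|\<close> hyperedges contain it and
  blue otherwise. A red copy of \<open>F - e\<close> inside a hyperedge \<open>h\<close> would extend greedily to a Berge-\<open>F\<close>
  in which \<open>h\<close> plays the role of \<open>e\<close>; so every hyperedge \<open>h\<close> contains a blue clique \<open>Q h\<close> on \<open>k\<close>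
  vertices, and every pair lies in a bounded number of these cliques.

  If \<open>|H| > \<epsilon> n\<^sup>2\<close>, apply Szemeredi's regularity lemma to the union of the cliques. Only few pairs
  are irregular, sparse or in small blocks, and each kills a bounded number of cliques, so some
  clique survives; its vertices lie in large blocks that are pairwise dense and regular. Embed \<open>F\<close>
  greedily into these blocks along a proper \<open>k\<close>-colouring, never placing three vertices into the
  same clique. Two placed vertices rule out only boundedly many positions, so this costs nothing,
  and it makes the hyperedges chosen for the edges of \<open>F\<close> distinct: \<open>H\<close> contains a Berge-\<open>F\<close> after
  all.
\<close>

section \<open>Block means\<close>

text \<open>A labelling \<open>p\<close> stands for the partition of a set into its level sets.\<close>

definition block :: "'z set \<Rightarrow> ('z \<Rightarrow> 'l) \<Rightarrow> 'z \<Rightarrow> 'z set" where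
  "block Z p z = {w \<in> Z. p w = p z}"

definition block_mean :: "'z set \<Rightarrow> ('z \<Rightarrow> 'l) \<Rightarrow> ('z \<Rightarrow> real) \<Rightarrow> 'z \<Rightarrow> real" where
  "block_mean Z p f z = (\<Sum>w\<in>block Z p z. f w) / card (block Z p z)"

definition refines :: "('z \<Rightarrow> 'k) \<Rightarrow> ('z \<Rightarrow> 'l) \<Rightarrow> bool" where
  "refines q p \<longleftrightarrow> (\<forall>z w. q z = q w \<longrightarrow> p z = p w)"

lemma finite_block: "finite Z \<Longrightarrow> finite (block Z p z)"
  by (simp add: block_def)

lemma block_map_prod:
  "block (X \<times> Y) (map_prod p q) z = block X p (fst z) \<times> block Y q (snd z)"
  by (cases z) (auto simp: block_def)

lemma map_prod_eq_iff:
  "map_prod p q z = map_prod p q w \<longleftrightarrow> p (fst z) = p (fst w) \<and> q (snd z) = q (snd w)"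
  by (simp add: prod_eq_iff)

lemma card_block_pos:
  assumes "finite Z" "z \<in> Z"
  shows "0 < card (block Z p z)"
  using assms finite_block[of Z p z] by (auto simp: card_gt_0_iff block_def)

lemma block_mean_cong: "p z = p w \<Longrightarrow> block_mean Z p f z = block_mean Z p f w"
  by (simp add: block_mean_def block_def)

lemma block_mean_nonneg:
  assumes "\<And>w. w \<in> Z \<Longrightarrow> 0 \<le> f w"
  shows "0 \<le> block_mean Z p f z"
  using assms by (auto simp: block_mean_def block_def intro!: divide_nonneg_nonneg sum_nonneg)

lemma block_mean_le_1:
  assumes "\<And>w. w \<in> Z \<Longrightarrow> f w \<le> 1"
  shows "block_mean Z p f z \<le> 1"
proof -
  have "(\<Sum>w\<in>block Z p z. f w) \<le> (\<Sum>w\<in>block Z p z. 1)"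
    using assms by (intro sum_mono) (simp add: block_def)
  then show ?thesis by (auto simp: block_mean_def divide_le_eq_1)
qed

lemma sum_block_mean_mult:
  assumes fin: "finite Z"
    and h_const: "\<And>z w. z \<in> Z \<Longrightarrow> w \<in> Z \<Longrightarrow> p z = p w \<Longrightarrow> h z = h w"
  shows "(\<Sum>z\<in>Z. block_mean Z p f z * h z) = (\<Sum>z\<in>Z. f z * h z)"
proof -
  have "(\<Sum>w | w \<in> Z \<and> p w = l. block_mean Z p f w * h w) = (\<Sum>w | w \<in> Z \<and> p w = l. f w * h w)"
    if l: "l \<in> p ` Z" for l
  proof -
    obtain z where z: "z \<in> Z" "l = p z" using l by blast
    have level: "{w \<in> Z. p w = l} = block Z p z" by (simp add: block_def z)
    have on_block: "h w = h z" "block_mean Z p f w = block_mean Z p f z" if "w \<in> block Z p z" for w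
      using that h_const[of w z] z block_mean_cong[of p w z] by (auto simp: block_def)
    have "(\<Sum>w\<in>block Z p z. block_mean Z p f w * h w) = (\<Sum>w\<in>block Z p z. block_mean Z p f z * h z)"
      by (intro sum.cong refl) (metis on_block)
    also have "\<dots> = (\<Sum>w\<in>block Z p z. f w) * h z"
      using card_block_pos[OF fin z(1), of p] by (simp add: block_mean_def)
    also have "\<dots> = (\<Sum>w\<in>block Z p z. f w * h w)"
      unfolding sum_distrib_right by (intro sum.cong refl) (metis on_block(1))
    finally show ?thesis by (simp only: level)
  qed
  then show ?thesis
    unfolding sum.image_gen[OF fin, of "\<lambda>z. block_mean Z p f z * h z" p]
      sum.image_gen[OF fin, of "\<lambda>z. f z * h z" p]
    by (rule sum.cong[OF refl])
qed

lemma block_mean_pythagoras: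
  assumes fin: "finite Z" and refine: "refines q p"
  shows "(\<Sum>z\<in>Z. (block_mean Z p f z - block_mean Z q f z)\<^sup>2)
       = (\<Sum>z\<in>Z. (block_mean Z q f z)\<^sup>2) - (\<Sum>z\<in>Z. (block_mean Z p f z)\<^sup>2)"
proof -
  let ?g = "block_mean Z p f" and ?g' = "block_mean Z q f"
  have "(\<Sum>z\<in>Z. ?g' z * ?g z) = (\<Sum>z\<in>Z. f z * ?g z)"
    using refine unfolding refines_def by (intro sum_block_mean_mult[OF fin] block_mean_cong) blast
  moreover have "(\<Sum>z\<in>Z. ?g z * ?g z) = (\<Sum>z\<in>Z. f z * ?g z)"
    by (intro sum_block_mean_mult[OF fin] block_mean_cong)
  ultimately have "(\<Sum>z\<in>Z. ?g' z * ?g z) = (\<Sum>z\<in>Z. ?g z * ?g z)" by simp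
  moreover have "(\<Sum>z\<in>Z. (?g z - ?g' z)\<^sup>2)
      = (\<Sum>z\<in>Z. (?g' z)\<^sup>2) - 2 * (\<Sum>z\<in>Z. ?g' z * ?g z) + (\<Sum>z\<in>Z. ?g z * ?g z)"
    by (simp add: sum_distrib_left sum_subtractf[symmetric] sum.distrib[symmetric]
        power2_eq_square algebra_simps)
  ultimately show ?thesis by (simp add: power2_eq_square)
qed

lemma block_mean_power2_ge:
  fixes f :: "'z \<Rightarrow> real" and \<alpha> \<eta> :: real
  assumes fin: "finite Z" and z: "z \<in> Z" and S: "S \<subseteq> block Z p z"
    and large: "\<alpha> * card (block Z p z) \<le> card S"
    and mean: "\<eta> * card S \<le> (\<Sum>w\<in>S. f w)" and \<eta>: "0 \<le> \<eta>"
  shows "\<eta>\<^sup>2 * \<alpha> \<le> block_mean Z p (\<lambda>w. (f w)\<^sup>2) z"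
proof -
  \<comment> \<open>Summing \<open>t\<^sup>2 \<ge> 2 \<eta> t - \<eta>\<^sup>2\<close> over \<open>S\<close> replaces the Cauchy-Schwarz inequality.\<close>
  have "\<eta>\<^sup>2 * \<alpha> * card (block Z p z) \<le> \<eta>\<^sup>2 * card S"
    unfolding mult.assoc by (intro mult_left_mono large) simp
  also have "\<dots> = 2 * \<eta> * (\<eta> * card S) - \<eta>\<^sup>2 * card S"
    by (simp add: power2_eq_square)
  also have "\<dots> \<le> 2 * \<eta> * (\<Sum>w\<in>S. f w) - \<eta>\<^sup>2 * card S"
    by (intro diff_right_mono mult_left_mono mean) (use \<eta> in simp)
  also have "\<dots> = (\<Sum>w\<in>S. 2 * \<eta> * f w - \<eta>\<^sup>2)"
    by (simp add: sum_subtractf sum_distrib_left[symmetric])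
  also have "\<dots> \<le> (\<Sum>w\<in>S. (f w)\<^sup>2)"
  proof (rule sum_mono)
    fix w
    have "0 \<le> (f w - \<eta>)\<^sup>2" by simp
    then show "2 * \<eta> * f w - \<eta>\<^sup>2 \<le> (f w)\<^sup>2" by (simp add: power2_diff algebra_simps)
  qed
  also have "\<dots> \<le> (\<Sum>w\<in>block Z p z. (f w)\<^sup>2)"
    using S by (intro sum_mono2 finite_block fin) auto
  finally show ?thesis
    using card_block_pos[OF fin z, of p] by (simp add: block_mean_def le_divide_eq)
qed

section \<open>Regularity\<close>

definition sparse_subpair ::
  "real \<Rightarrow> real \<Rightarrow> ('v \<times> 'v) set \<Rightarrow> 'v set \<Rightarrow> 'v set \<Rightarrow> 'v set \<Rightarrow> 'v set \<Rightarrow> bool" where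
  "sparse_subpair \<eta> d R A B A' B' \<longleftrightarrow> A' \<subseteq> A \<and> B' \<subseteq> B \<and>
     \<eta> * card A \<le> real (card A') \<and> \<eta> * card B \<le> real (card B') \<and>
     real (card (R \<inter> A' \<times> B')) < d * (card A' * card B')"

definition lower_regular :: "real \<Rightarrow> real \<Rightarrow> ('v \<times> 'v) set \<Rightarrow> 'v set \<Rightarrow> 'v set \<Rightarrow> bool" where
  "lower_regular \<eta> d R A B \<longleftrightarrow> (\<nexists>A' B'. sparse_subpair \<eta> d R A B A' B')"

definition block_density :: "'v set \<Rightarrow> ('v \<times> 'v) set \<Rightarrow> ('v \<Rightarrow> 'l) \<Rightarrow> 'v \<times> 'v \<Rightarrow> real" where
  "block_density X R p = block_mean (X \<times> X) (map_prod p p) (indicator R)"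

text \<open>One-sided regularity suffices: only subpairs of too small density count as irregularity.\<close>

definition irregularity_witness ::
  "real \<Rightarrow> 'v set \<Rightarrow> ('v \<times> 'v) set \<Rightarrow> ('v \<Rightarrow> 'l) \<Rightarrow> 'v \<times> 'v \<Rightarrow> 'v set \<Rightarrow> 'v set \<Rightarrow> bool" where
  "irregularity_witness \<eta> X R p z =
     sparse_subpair \<eta> (block_density X R p z - \<eta>) R (block X p (fst z)) (block X p (snd z))"

definition irregular_pairs ::
  "real \<Rightarrow> 'v set \<Rightarrow> ('v \<times> 'v) set \<Rightarrow> ('v \<Rightarrow> 'l) \<Rightarrow> ('v \<times> 'v) set" where
  "irregular_pairs \<eta> X R p = {z \<in> X \<times> X. \<exists>A B. irregularity_witness \<eta> X R p z A B}"

definition energy :: "'v set \<Rightarrow> ('v \<times> 'v) set \<Rightarrow> ('v \<Rightarrow> 'l) \<Rightarrow> real" where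
  "energy X R p = (\<Sum>z\<in>X\<times>X. (block_density X R p z)\<^sup>2)"

definition saturated :: "('v \<Rightarrow> 'l) \<Rightarrow> 'v set \<Rightarrow> bool" where
  "saturated p A \<longleftrightarrow> (\<forall>x y. p x = p y \<longrightarrow> (x \<in> A \<longleftrightarrow> y \<in> A))"

lemma lower_regularD:
  fixes \<eta> d :: real
  assumes "lower_regular \<eta> d R A B" "A' \<subseteq> A" "B' \<subseteq> B" "\<eta> * card A \<le> card A'" "\<eta> * card B \<le> card B'"
  shows "d * (card A' * card B') \<le> card (R \<inter> A' \<times> B')"
  using assms unfolding lower_regular_def sparse_subpair_def by (simp add: not_less)

lemma lower_regular_antimono:
  fixes d d' :: real
  assumes "lower_regular \<eta> d' R A B" "d \<le> d'"
  shows "lower_regular \<eta> d R A B"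
proof -
  have "sparse_subpair \<eta> d' R A B A' B'" if "sparse_subpair \<eta> d R A B A' B'" for A' B'
  proof -
    have "d * (card A' * card B') \<le> d' * (card A' * card B')"
      using assms(2) by (intro mult_right_mono) auto
    then show ?thesis using that by (simp add: sparse_subpair_def)
  qed
  then show ?thesis using assms(1) unfolding lower_regular_def by blast
qed

lemma refines_map_prod: "refines q p \<Longrightarrow> refines (map_prod q q) (map_prod p p)"
  unfolding refines_def map_prod_eq_iff by blast

lemma block_density_cong:
  "map_prod p p z = map_prod p p w \<Longrightarrow> block_density X R p z = block_density X R p w"
  unfolding block_density_def by (rule block_mean_cong)

lemma irregularity_witness_cong:
  fixes \<eta> :: real
  assumes "map_prod p p z = map_prod p p w"
  shows "irregularity_witness \<eta> X R p z = irregularity_witness \<eta> X R p w"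
proof -
  have "block X p (fst z) = block X p (fst w)" "block X p (snd z) = block X p (snd w)"
    using assms by (simp_all only: block_def map_prod_eq_iff)
  then show ?thesis
    using block_density_cong[OF assms] by (simp only: irregularity_witness_def)
qed

lemma irregular_pairs_cong:
  assumes "z \<in> X \<times> X" "w \<in> X \<times> X" "map_prod p p z = map_prod p p w"
  shows "z \<in> irregular_pairs \<eta> X R p \<longleftrightarrow> w \<in> irregular_pairs \<eta> X R p"
  using assms(1,2) irregularity_witness_cong[OF assms(3)]
  by (simp only: irregular_pairs_def mem_Collect_eq)

lemma finite_irregular_pairs: "finite X \<Longrightarrow> finite (irregular_pairs \<eta> X R p)"
  by (simp add: irregular_pairs_def)

lemma energy_nonneg: "0 \<le> energy X R p"
  by (simp add: energy_def sum_nonneg)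

lemma energy_le: "energy X R p \<le> (card X)\<^sup>2"
proof -
  have "energy X R p \<le> (\<Sum>z\<in>X\<times>X. 1)"
    unfolding energy_def block_density_def
    by (intro sum_mono power_le_one block_mean_nonneg block_mean_le_1) (auto simp: indicator_def)
  then show ?thesis by (simp add: card_cartesian_product power2_eq_square)
qed

lemma sum_block_density:
  assumes fin: "finite X" and AB: "A \<subseteq> X" "B \<subseteq> X" and sat: "saturated p A" "saturated p B"
  shows "(\<Sum>z\<in>A \<times> B. block_density X R p z) = card (R \<inter> A \<times> B)"
proof -
  have restrict: "(\<Sum>z\<in>X \<times> X. g z * indicator (A \<times> B) z) = (\<Sum>z\<in>A \<times> B. g z)"
    for g :: "'a \<times> 'a \<Rightarrow> real"
    using AB fin by (intro sum.mono_neutral_cong_right) (auto simp: indicator_def)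
  have "(\<Sum>z\<in>X \<times> X. block_density X R p z * indicator (A \<times> B) z)
      = (\<Sum>z\<in>X \<times> X. indicator R z * indicator (A \<times> B) z)"
    unfolding block_density_def
  proof (rule sum_block_mean_mult)
    fix z w assume "map_prod p p z = map_prod p p w"
    then have "z \<in> A \<times> B \<longleftrightarrow> w \<in> A \<times> B"
      using sat unfolding saturated_def map_prod_eq_iff mem_Times_iff by blast
    then show "(indicator (A \<times> B) z :: real) = indicator (A \<times> B) w"
      by (simp add: indicator_def)
  qed (use fin in simp)
  then have "(\<Sum>z\<in>A \<times> B. block_density X R p z) = (\<Sum>z\<in>A \<times> B. indicator R z)"
    by (simp only: restrict)
  also have "\<dots> = card (R \<inter> A \<times> B)"
    using finite_subset[OF AB(1) fin] finite_subset[OF AB(2) fin]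
    by (simp add: indicator_def sum.If_cases Int_commute)
  finally show ?thesis .
qed

lemma block_mean_density_gain:
  fixes \<eta> :: real
  assumes fin: "finite X" and z: "z \<in> X \<times> X" and \<eta>: "0 \<le> \<eta>"
    and witness: "irregularity_witness \<eta> X R p z A B"
    and sat: "saturated q A" "saturated q B"
  shows "\<eta>^4 \<le> block_mean (X \<times> X) (map_prod p p)
    (\<lambda>w. (block_density X R p w - block_density X R q w)\<^sup>2) z"
proof -
  let ?C = "block X p (fst z)" and ?D = "block X p (snd z)"
  have AB: "A \<subseteq> ?C" "B \<subseteq> ?D"
    and large: "\<eta> * card ?C \<le> card A" "\<eta> * card ?D \<le> card B"
    and few: "card (R \<inter> A \<times> B) < (block_density X R p z - \<eta>) * (card A * card B)"
    using witness by (auto simp: irregularity_witness_def sparse_subpair_def)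
  have "\<eta>\<^sup>2 * \<eta>\<^sup>2 \<le> block_mean (X \<times> X) (map_prod p p)
    (\<lambda>w. (block_density X R p w - block_density X R q w)\<^sup>2) z"
  proof (rule block_mean_power2_ge[OF _ z _ _ _ \<eta>])
    show "A \<times> B \<subseteq> block (X \<times> X) (map_prod p p) z" using AB by (auto simp: block_map_prod)
    have "(\<eta> * card ?C) * (\<eta> * card ?D) \<le> real (card A) * card B"
      using large \<eta> by (intro mult_mono) auto
    then show "\<eta>\<^sup>2 * card (block (X \<times> X) (map_prod p p) z) \<le> card (A \<times> B)"
      by (simp add: block_map_prod card_cartesian_product power2_eq_square mult_ac)
    have "block_density X R p w = block_density X R p z" if "w \<in> A \<times> B" for w
    proof (rule block_density_cong)
      have "fst w \<in> ?C" "snd w \<in> ?D" using that AB by auto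
      then show "map_prod p p w = map_prod p p z" by (simp add: block_def map_prod_eq_iff)
    qed
    then have "(\<Sum>w\<in>A \<times> B. block_density X R p w) = (\<Sum>w\<in>A \<times> B. block_density X R p z)"
      by (rule sum.cong[OF refl])
    moreover have "(\<Sum>w\<in>A \<times> B. block_density X R q w) = card (R \<inter> A \<times> B)"
      using AB by (intro sum_block_density fin sat) (auto simp: block_def)
    ultimately show "\<eta> * card (A \<times> B) \<le> (\<Sum>w\<in>A \<times> B. block_density X R p w - block_density X R q w)"
      using few by (simp add: sum_subtractf card_cartesian_product algebra_simps)
  qed (use fin in simp)
  then show ?thesis by (simp add: power4_eq_xxxx power2_eq_square mult.assoc)
qed

lemma energy_increment:
  fixes \<eta> :: real
  assumes fin: "finite X" and \<eta>: "0 \<le> \<eta>" and refine: "refines q p"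
    and sep: "\<And>z. z \<in> irregular_pairs \<eta> X R p \<Longrightarrow>
      \<exists>A B. saturated q A \<and> saturated q B \<and> irregularity_witness \<eta> X R p z A B"
  shows "energy X R p + \<eta>^4 * card (irregular_pairs \<eta> X R p) \<le> energy X R q"
proof -
  let ?I = "irregular_pairs \<eta> X R p"
  let ?\<Delta> = "\<lambda>w. (block_density X R p w - block_density X R q w)\<^sup>2"
  have I: "?I \<subseteq> X \<times> X" by (auto simp: irregular_pairs_def)
  have "\<eta>^4 * card ?I = (\<Sum>z\<in>X \<times> X. \<eta>^4 * indicator ?I z)"
    using I fin by (simp add: sum_distrib_left[symmetric] indicator_def sum.If_cases Int_absorb1)
  also have "\<dots> \<le> (\<Sum>z\<in>X \<times> X. block_mean (X \<times> X) (map_prod p p) ?\<Delta> z * indicator ?I z)"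
  proof (rule sum_mono)
    fix z assume z: "z \<in> X \<times> X"
    have "\<eta>^4 \<le> block_mean (X \<times> X) (map_prod p p) ?\<Delta> z" if "z \<in> ?I"
      using sep[OF that] block_mean_density_gain[OF fin z \<eta>] by blast
    then show "\<eta>^4 * indicator ?I z \<le> block_mean (X \<times> X) (map_prod p p) ?\<Delta> z * indicator ?I z"
      by (simp add: indicator_def)
  qed
  also have "\<dots> = (\<Sum>z\<in>X \<times> X. ?\<Delta> z * indicator ?I z)"
  proof (rule sum_block_mean_mult)
    fix z w assume "z \<in> X \<times> X" "w \<in> X \<times> X" "map_prod p p z = map_prod p p w"
    then have "z \<in> ?I \<longleftrightarrow> w \<in> ?I" by (rule irregular_pairs_cong)
    then show "(indicator ?I z :: real) = indicator ?I w" by (simp add: indicator_def)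
  qed (use fin in simp)
  also have "\<dots> \<le> (\<Sum>z\<in>X \<times> X. ?\<Delta> z)"
    by (intro sum_mono) (auto simp: indicator_def)
  also have "\<dots> = energy X R q - energy X R p"
    unfolding energy_def block_density_def
    using fin refine by (intro block_mean_pythagoras refines_map_prod) auto
  finally show ?thesis by simp
qed

lemma ex_irregularity_witness_family:
  fixes \<eta> :: real
  assumes fin: "finite X"
  obtains \<W> where "finite \<W>" "card \<W> \<le> 2 * (card (p ` X))\<^sup>2"
    "\<And>z. z \<in> irregular_pairs \<eta> X R p \<Longrightarrow> \<exists>A\<in>\<W>. \<exists>B\<in>\<W>. irregularity_witness \<eta> X R p z A B"
proof -
  let ?I = "irregular_pairs \<eta> X R p"
  define labels where "labels = map_prod p p ` ?I"
  have "labels \<subseteq> p ` X \<times> p ` X" by (auto simp: labels_def irregular_pairs_def)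
  then have fin_labels: "finite labels" and card_labels: "card labels \<le> (card (p ` X))\<^sup>2"
    using fin card_mono[of "p ` X \<times> p ` X" labels]
    by (auto intro: finite_subset simp: card_cartesian_product power2_eq_square)
  have "\<exists>A B. \<forall>z. map_prod p p z = l \<longrightarrow> irregularity_witness \<eta> X R p z A B"
    if l: "l \<in> labels" for l
  proof -
    obtain w A B where "l = map_prod p p w" "irregularity_witness \<eta> X R p w A B"
      using l by (auto simp: labels_def irregular_pairs_def)
    then show ?thesis using irregularity_witness_cong by metis
  qed
  then obtain A B where AB: "\<And>l z. \<lbrakk>l \<in> labels; map_prod p p z = l\<rbrakk> \<Longrightarrow>
      irregularity_witness \<eta> X R p z (A l) (B l)"
    by metis
  show thesis
  proof (rule that[of "A ` labels \<union> B ` labels"])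
    show "finite (A ` labels \<union> B ` labels)" using fin_labels by simp
    show "card (A ` labels \<union> B ` labels) \<le> 2 * (card (p ` X))\<^sup>2"
      using card_Un_le[of "A ` labels" "B ` labels"] card_labels
        card_image_le[OF fin_labels, of A] card_image_le[OF fin_labels, of B] by linarith
    fix z assume "z \<in> ?I"
    then have label: "map_prod p p z \<in> labels" by (simp add: labels_def)
    then show "\<exists>C\<in>A ` labels \<union> B ` labels. \<exists>D\<in>A ` labels \<union> B ` labels.
        irregularity_witness \<eta> X R p z C D"
      using AB[OF label refl] by blast
  qed
qed

text \<open>The partition generated by a family \<open>W\<close>: two points share a block iff they lie in the same
  members of \<open>W\<close>.\<close>

definition membership :: "'v set set \<Rightarrow> 'v \<Rightarrow> 'v set set" where
  "membership W x = {S \<in> W. x \<in> S}"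

lemma refines_membership: "W \<subseteq> W' \<Longrightarrow> refines (membership W') (membership W)"
  unfolding refines_def membership_def by blast

lemma saturated_membership: "S \<in> W \<Longrightarrow> saturated (membership W) S"
  by (auto simp: saturated_def membership_def)

lemma card_membership_image:
  assumes "finite W"
  shows "card (membership W ` X) \<le> 2 ^ card W"
proof -
  have "card (membership W ` X) \<le> card (Pow W)"
    using assms by (intro card_mono) (auto simp: membership_def)
  then show ?thesis using assms by (simp add: card_Pow)
qed

definition family_growth :: "nat \<Rightarrow> nat" where
  "family_growth w = w + 2 * (2 ^ w)\<^sup>2"

lemma mono_family_growth: "mono family_growth"
  unfolding family_growth_def
  by (intro monoI add_mono mult_left_mono power_mono power_increasing) auto

lemma energy_increment_membership:
  fixes \<eta> :: real
  assumes fin: "finite X" "finite W" and \<eta>: "0 \<le> \<eta>"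
  obtains W' where "finite W'" "card W' \<le> family_growth (card W)"
    "energy X R (membership W) + \<eta>^4 * card (irregular_pairs \<eta> X R (membership W))
      \<le> energy X R (membership W')"
proof -
  obtain \<W> where \<W>: "finite \<W>" "card \<W> \<le> 2 * (card (membership W ` X))\<^sup>2"
    "\<And>z. z \<in> irregular_pairs \<eta> X R (membership W) \<Longrightarrow>
      \<exists>A\<in>\<W>. \<exists>B\<in>\<W>. irregularity_witness \<eta> X R (membership W) z A B"
    using ex_irregularity_witness_family[OF fin(1), of "membership W" \<eta> R] by metis
  show thesis
  proof (rule that[of "W \<union> \<W>"])
    show "finite (W \<union> \<W>)" using fin \<W> by simp
    have "(card (membership W ` X))\<^sup>2 \<le> (2 ^ card W)\<^sup>2"
      by (intro power_mono card_membership_image fin) simp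
    then show "card (W \<union> \<W>) \<le> family_growth (card W)"
      using card_Un_le[of W \<W>] \<W>(2) unfolding family_growth_def by linarith
    show "energy X R (membership W) + \<eta>^4 * card (irregular_pairs \<eta> X R (membership W))
      \<le> energy X R (membership (W \<union> \<W>))"
    proof (rule energy_increment[OF fin(1) \<eta>])
      show "refines (membership (W \<union> \<W>)) (membership W)" by (rule refines_membership) simp
    next
      fix z assume "z \<in> irregular_pairs \<eta> X R (membership W)"
      from \<W>(3)[OF this] show "\<exists>A B. saturated (membership (W \<union> \<W>)) A \<and>
          saturated (membership (W \<union> \<W>)) B \<and> irregularity_witness \<eta> X R (membership W) z A B"
        using saturated_membership[of _ "W \<union> \<W>"] by blast
    qed
  qed
qed

lemma ex_regular_or_high_energy:
  fixes \<eta> :: real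
  assumes fin: "finite X" and \<eta>: "0 \<le> \<eta>"
  shows "\<exists>W. finite W \<and> card W \<le> (family_growth ^^ j) 0 \<and>
    (card (irregular_pairs \<eta> X R (membership W)) \<le> \<eta> * (card X)\<^sup>2 \<or>
     j * (\<eta>^5 * (card X)\<^sup>2) \<le> energy X R (membership W))"
proof (induction j)
  case 0
  show ?case by (intro exI[of _ "{}"]) (simp add: energy_nonneg)
next
  case (Suc j)
  let ?irregular = "\<lambda>W. irregular_pairs \<eta> X R (membership W)"
  obtain W where W: "finite W" "card W \<le> (family_growth ^^ j) 0"
    and alt: "card (?irregular W) \<le> \<eta> * (card X)\<^sup>2 \<or>
      j * (\<eta>^5 * (card X)\<^sup>2) \<le> energy X R (membership W)"
    using Suc.IH by blast
  have growth: "family_growth (card W) \<le> (family_growth ^^ Suc j) 0"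
    using monoD[OF mono_family_growth W(2)] by simp
  show ?case
  proof (cases "card (?irregular W) \<le> \<eta> * (card X)\<^sup>2")
    case True
    have "card W \<le> family_growth (card W)" by (simp add: family_growth_def)
    then show ?thesis using W(1) True growth by (intro exI[of _ W]) auto
  next
    case False
    obtain W' where W': "finite W'" "card W' \<le> family_growth (card W)"
      "energy X R (membership W) + \<eta>^4 * card (?irregular W) \<le> energy X R (membership W')"
      using energy_increment_membership[OF fin W(1) \<eta>] by blast
    have "\<eta>^5 * (card X)\<^sup>2 = \<eta>^4 * (\<eta> * (card X)\<^sup>2)" by (simp add: eval_nat_numeral)
    also have "\<dots> \<le> \<eta>^4 * card (?irregular W)"
      using False \<eta> by (intro mult_left_mono) auto
    finally have "Suc j * (\<eta>^5 * (card X)\<^sup>2) \<le> energy X R (membership W')"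
      using alt False W'(3) by (simp add: distrib_right)
    then show ?thesis using W' growth by (intro exI[of _ W']) auto
  qed
qed

lemma szemeredi_lower_regularity:
  fixes \<eta> :: real
  assumes \<eta>: "0 < \<eta>"
  obtains M where "\<And>(X :: 'v set) R. finite X \<Longrightarrow>
    \<exists>p :: 'v \<Rightarrow> 'v set set. card (p ` X) \<le> M \<and> card (irregular_pairs \<eta> X R p) \<le> \<eta> * (card X)\<^sup>2"
proof -
  obtain j :: nat where j: "1 < j * \<eta>^5"
    using reals_Archimedean3[of "\<eta>^5"] \<eta> by auto
  show thesis
  proof (rule that[of "2 ^ (family_growth ^^ j) 0"])
    fix X :: "'v set" and R :: "('v \<times> 'v) set"
    assume fin: "finite X"
    obtain W where W: "finite W" "card W \<le> (family_growth ^^ j) 0"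
      and alt: "card (irregular_pairs \<eta> X R (membership W)) \<le> \<eta> * (card X)\<^sup>2 \<or>
        j * (\<eta>^5 * (card X)\<^sup>2) \<le> energy X R (membership W)"
      using ex_regular_or_high_energy[OF fin less_imp_le[OF \<eta>], of j R] by blast
    have "card (membership W ` X) \<le> 2 ^ (family_growth ^^ j) 0"
      by (rule order_trans[OF card_membership_image[OF W(1)] power_increasing[OF W(2)]]) simp
    moreover have "card (irregular_pairs \<eta> X R (membership W)) \<le> \<eta> * (card X)\<^sup>2"
    proof (cases "X = {}")
      case True
      then show ?thesis by (simp add: irregular_pairs_def)
    next
      case False
      then have "1 * real ((card X)\<^sup>2) < (j * \<eta>^5) * (card X)\<^sup>2"
        using j fin by (intro mult_strict_right_mono) (auto simp: card_gt_0_iff)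
      then show ?thesis
        using alt energy_le[of X R "membership W"] by (simp add: mult.assoc)
    qed
    ultimately show "\<exists>p :: 'v \<Rightarrow> 'v set set. card (p ` X) \<le> 2 ^ (family_growth ^^ j) 0 \<and>
        card (irregular_pairs \<eta> X R p) \<le> \<eta> * (card X)\<^sup>2"
      by (intro exI[of _ "membership W"] conjI)
  qed
qed

definition exceptional_pairs ::
  "real \<Rightarrow> real \<Rightarrow> nat \<Rightarrow> 'v set \<Rightarrow> ('v \<times> 'v) set \<Rightarrow> ('v \<Rightarrow> 'l) \<Rightarrow> ('v \<times> 'v) set" where
  "exceptional_pairs \<eta> d L X R p = irregular_pairs \<eta> X R p \<union>
     R \<inter> {z \<in> X \<times> X. block_density X R p z < d + \<eta>} \<union>
     {x \<in> X. card (block X p x) < L} \<times> X"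

lemma card_small_blocks:
  assumes fin: "finite X"
  shows "card {x \<in> X. card (block X p x) < L} \<le> card (p ` X) * L"
proof -
  let ?S = "{x \<in> X. card (block X p x) < L}"
  have "card ?S \<le> card (\<Union>l\<in>p ` ?S. {x \<in> X. p x = l})"
    using fin by (intro card_mono) auto
  also have "\<dots> \<le> (\<Sum>l\<in>p ` ?S. card {x \<in> X. p x = l})"
    using fin by (intro card_UN_le) simp
  also have "\<dots> \<le> (\<Sum>l\<in>p ` ?S. L)"
    by (intro sum_mono) (auto simp: block_def)
  also have "\<dots> = card (p ` ?S) * L"
    by simp
  also have "\<dots> \<le> card (p ` X) * L"
    using fin by (intro mult_le_mono1 card_mono) auto
  finally show ?thesis .
qed

lemma card_sparse_edges:
  fixes d :: real
  assumes fin: "finite X" and d: "0 \<le> d"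
  shows "card (R \<inter> {z \<in> X \<times> X. block_density X R p z < d}) \<le> d * (card X)\<^sup>2"
proof -
  let ?D = "{z \<in> X \<times> X. block_density X R p z < d}"
  have "real (card (R \<inter> ?D)) = (\<Sum>z\<in>R \<inter> ?D. 1)"
    by simp
  also have "\<dots> = (\<Sum>z\<in>X \<times> X. indicator R z * indicator ?D z)"
    by (rule sum.mono_neutral_cong_left) (use fin in \<open>auto simp: indicator_def\<close>)
  also have "\<dots> = (\<Sum>z\<in>X \<times> X. block_density X R p z * indicator ?D z)"
    unfolding block_density_def
  proof (rule sum_block_mean_mult[symmetric])
    fix z w assume "z \<in> X \<times> X" "w \<in> X \<times> X" "map_prod p p z = map_prod p p w"
    then show "indicator {z \<in> X \<times> X. block_mean (X \<times> X) (map_prod p p) (indicator R) z < d} z =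
      (indicator {z \<in> X \<times> X. block_mean (X \<times> X) (map_prod p p) (indicator R) z < d} w :: real)"
      using block_mean_cong[of "map_prod p p" z w] by (simp add: indicator_def)
  qed (use fin in simp)
  also have "\<dots> \<le> (\<Sum>z\<in>X \<times> X. d)"
    using d by (intro sum_mono) (auto simp: indicator_def)
  also have "\<dots> = d * (card X)\<^sup>2"
    by (simp add: card_cartesian_product power2_eq_square)
  finally show ?thesis .
qed

lemma finite_exceptional_pairs: "finite X \<Longrightarrow> finite (exceptional_pairs \<eta> d L X R p)"
  by (simp add: exceptional_pairs_def finite_irregular_pairs)

lemma card_exceptional_pairs:
  fixes \<eta> d :: real
  assumes fin: "finite X" and d\<eta>: "0 \<le> d + \<eta>"
    and irregular: "card (irregular_pairs \<eta> X R p) \<le> \<eta> * (card X)\<^sup>2"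
    and blocks: "card (p ` X) * L \<le> d * card X"
  shows "card (exceptional_pairs \<eta> d L X R p) \<le> 2 * (d + \<eta>) * (card X)\<^sup>2"
proof -
  let ?sparse = "R \<inter> {z \<in> X \<times> X. block_density X R p z < d + \<eta>}"
  let ?small = "{x \<in> X. card (block X p x) < L}"
  have "real (card (?small \<times> X)) = real (card ?small) * card X"
    by (simp add: card_cartesian_product)
  also have "\<dots> \<le> real (card (p ` X) * L) * card X"
    using card_small_blocks[OF fin, of p L]
    by (intro mult_right_mono) (simp_all only: of_nat_le_iff)
  also have "\<dots> \<le> (d * card X) * card X"
    using blocks by (intro mult_right_mono) auto
  finally have "real (card (?small \<times> X)) \<le> d * (card X)\<^sup>2"
    by (simp add: power2_eq_square)
  moreover have "real (card ?sparse) \<le> (d + \<eta>) * (card X)\<^sup>2"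
    by (rule card_sparse_edges[OF fin d\<eta>])
  moreover have "card (exceptional_pairs \<eta> d L X R p)
      \<le> card (irregular_pairs \<eta> X R p) + card ?sparse + card (?small \<times> X)"
    unfolding exceptional_pairs_def by (meson add_right_mono card_Un_le order_trans)
  ultimately show ?thesis
    using irregular by (simp add: algebra_simps)
qed

lemma lower_regular_if_not_exceptional:
  assumes "(x, y) \<in> R" "x \<in> X" "y \<in> X" "(x, y) \<notin> exceptional_pairs \<eta> d L X R p"
  shows "L \<le> card (block X p x)" "lower_regular \<eta> d R (block X p x) (block X p y)"
proof -
  show "L \<le> card (block X p x)"
    using assms by (auto simp: exceptional_pairs_def)
  have "lower_regular \<eta> (block_density X R p (x, y) - \<eta>) R (block X p x) (block X p y)"
    using assms
    by (auto simp: exceptional_pairs_def irregular_pairs_def irregularity_witness_def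
        lower_regular_def)
  then show "lower_regular \<eta> d R (block X p x) (block X p y)"
    using assms by (elim lower_regular_antimono) (auto simp: exceptional_pairs_def)
qed

section \<open>Families of sets with bounded codegree\<close>

definition codegree :: "'h set \<Rightarrow> ('h \<Rightarrow> 'v set) \<Rightarrow> 'v set \<Rightarrow> nat" where
  "codegree H Q s = card {h \<in> H. s \<subseteq> Q h}"

definition bounded_codegree :: "nat \<Rightarrow> 'h set \<Rightarrow> ('h \<Rightarrow> 'v set) \<Rightarrow> bool" where
  "bounded_codegree m H Q \<longleftrightarrow> (\<forall>s. card s = 2 \<longrightarrow> codegree H Q s \<le> m)"

definition shadow :: "'h set \<Rightarrow> ('h \<Rightarrow> 'v set) \<Rightarrow> ('v \<times> 'v) set" where
  "shadow H Q = {(x, y). x \<noteq> y \<and> (\<exists>h\<in>H. {x, y} \<subseteq> Q h)}"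

definition regular_blowup ::
  "real \<Rightarrow> real \<Rightarrow> nat \<Rightarrow> 'v set \<Rightarrow> ('v \<times> 'v) set \<Rightarrow> 'v set \<Rightarrow> ('v \<Rightarrow> 'v set) \<Rightarrow> bool" where
  "regular_blowup \<eta> d L X R q A \<longleftrightarrow> (\<forall>x\<in>q. A x \<subseteq> X \<and> L \<le> card (A x)) \<and>
     (\<forall>x\<in>q. \<forall>y\<in>q. x \<noteq> y \<longrightarrow> lower_regular \<eta> d R (A x) (A y))"

lemma sym_shadow: "sym (shadow H Q)"
  by (auto simp: sym_def shadow_def)

lemma ex_member_avoiding_pairs:
  assumes fin: "finite B" and codeg: "bounded_codegree m H Q"
    and big: "card B * m < card H"
  obtains h where "h \<in> H" "\<And>x y. x \<in> Q h \<Longrightarrow> y \<in> Q h \<Longrightarrow> x \<noteq> y \<Longrightarrow> (x, y) \<notin> B"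
proof -
  let ?hit = "\<lambda>(x, y). if x = y then {} else {h \<in> H. {x, y} \<subseteq> Q h}"
  have finH: "finite H" using big card_ge_0_finite by force
  have "card (\<Union>z\<in>B. ?hit z) \<le> (\<Sum>z\<in>B. card (?hit z))"
    by (rule card_UN_le[OF fin])
  also have "\<dots> \<le> (\<Sum>z\<in>B. m)"
  proof (rule sum_mono)
    fix z show "card (?hit z) \<le> m"
      using codeg[unfolded bounded_codegree_def codegree_def, rule_format, of "{fst z, snd z}"]
      by (cases z) simp
  qed
  also have "\<dots> < card H" using big by simp
  finally have "\<not> H \<subseteq> (\<Union>z\<in>B. ?hit z)"
    using card_mono[of "\<Union>z\<in>B. ?hit z" H] fin finH by (fastforce simp: not_le)
  then obtain h where "h \<in> H" "h \<notin> (\<Union>z\<in>B. ?hit z)" by blast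
  then show thesis by (intro that[of h]) force+
qed

lemma ex_regular_member:
  fixes \<eta> d :: real
  assumes fin: "finite X" and QX: "\<Union>(Q ` H) \<subseteq> X" and Q2: "\<forall>h\<in>H. 2 \<le> card (Q h)"
    and codeg: "bounded_codegree m H Q"
    and few: "card (exceptional_pairs \<eta> d L X (shadow H Q) p) * m < card H"
  shows "\<exists>h\<in>H. regular_blowup \<eta> d L X (shadow H Q) (Q h) (block X p)"
proof -
  let ?B = "exceptional_pairs \<eta> d L X (shadow H Q) p"
  obtain h where h: "h \<in> H" "\<And>x y. x \<in> Q h \<Longrightarrow> y \<in> Q h \<Longrightarrow> x \<noteq> y \<Longrightarrow> (x, y) \<notin> ?B"
    using ex_member_avoiding_pairs[OF finite_exceptional_pairs[OF fin] codeg few] by blast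
  have regular: "L \<le> card (block X p x)"
    "lower_regular \<eta> d (shadow H Q) (block X p x) (block X p y)"
    if "x \<in> Q h" "y \<in> Q h" "x \<noteq> y" for x y
  proof -
    have "(x, y) \<in> shadow H Q" "x \<in> X" "y \<in> X" using that h(1) QX by (auto simp: shadow_def)
    from lower_regular_if_not_exceptional[OF this h(2)[OF that]]
    show "L \<le> card (block X p x)"
      "lower_regular \<eta> d (shadow H Q) (block X p x) (block X p y)" .
  qed
  have "\<exists>y\<in>Q h. x \<noteq> y" for x
  proof -
    have "\<not> Q h \<subseteq> {x}" using bspec[OF Q2 h(1)] card_mono[of "{x}" "Q h"] by auto
    then show ?thesis by auto
  qed
  then have "regular_blowup \<eta> d L X (shadow H Q) (Q h) (block X p)"
    unfolding regular_blowup_def using regular by (auto simp: block_def)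
  then show ?thesis using h(1) by blast
qed

lemma eventually_ex_regular_member:
  fixes \<eta> d :: real
  assumes \<eta>: "0 < \<eta>" and d: "0 < d"
  shows "\<forall>\<^sub>F n in sequentially. \<forall>(X :: 'v set) (H :: 'h set) Q.
    finite X \<and> card X = n \<and> \<Union>(Q ` H) \<subseteq> X \<and> (\<forall>h\<in>H. 2 \<le> card (Q h)) \<and> bounded_codegree m H Q \<and>
    2 * (d + \<eta>) * m * (real n)\<^sup>2 < card H \<longrightarrow>
    (\<exists>h\<in>H. \<exists>A. regular_blowup \<eta> d L X (shadow H Q) (Q h) A)"
proof -
  obtain M where M: "\<And>(X :: 'v set) R. finite X \<Longrightarrow>
    \<exists>p :: 'v \<Rightarrow> 'v set set. card (p ` X) \<le> M \<and> card (irregular_pairs \<eta> X R p) \<le> \<eta> * (card X)\<^sup>2"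
    using szemeredi_lower_regularity[OF \<eta>] by blast
  obtain n0 :: nat where n0: "real (M * L) < n0 * d"
    using reals_Archimedean3[OF d] by blast
  show ?thesis
  proof (rule eventually_sequentiallyI[of n0], intro allI impI, elim conjE)
    fix n and X :: "'v set" and H :: "'h set" and Q
    assume n: "n0 \<le> n" and fin: "finite X" and card_X: "card X = n"
      and family: "\<Union>(Q ` H) \<subseteq> X" "\<forall>h\<in>H. 2 \<le> card (Q h)" "bounded_codegree m H Q"
      and big: "2 * (d + \<eta>) * m * (real n)\<^sup>2 < card H"
    obtain p :: "'v \<Rightarrow> 'v set set" where p: "card (p ` X) \<le> M"
      "card (irregular_pairs \<eta> X (shadow H Q) p) \<le> \<eta> * (card X)\<^sup>2"
      using M[OF fin] by blast
    let ?B = "exceptional_pairs \<eta> d L X (shadow H Q) p"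
    have "real (card (p ` X) * L) \<le> real (M * L)"
      using p(1) by (simp only: of_nat_le_iff mult_le_mono1)
    also have "\<dots> \<le> n0 * d" using n0 by simp
    also have "\<dots> \<le> d * card X" using n card_X d by (simp add: mult.commute mult_left_mono)
    finally have "real (card ?B) \<le> 2 * (d + \<eta>) * (card X)\<^sup>2"
      using d \<eta> p(2) by (intro card_exceptional_pairs fin) auto
    then have "real (card ?B) * m \<le> 2 * (d + \<eta>) * (card X)\<^sup>2 * m"
      by (rule mult_right_mono) simp
    then have "real (card ?B * m) < card H" using big card_X by (simp add: mult_ac)
    then have "card ?B * m < card H" by (simp only: of_nat_less_iff)
    then show "\<exists>h\<in>H. \<exists>A. regular_blowup \<eta> d L X (shadow H Q) (Q h) A"
      using ex_regular_member[OF fin family] by blast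
  qed
qed

definition general_position :: "'v set set \<Rightarrow> 'v set \<Rightarrow> bool" where
  "general_position \<L> T \<longleftrightarrow> (\<forall>l\<in>\<L>. card (T \<inter> l) \<le> 2)"

definition obstructed :: "('v set \<Rightarrow> bool) \<Rightarrow> 'v set \<Rightarrow> 'v set" where
  "obstructed P T = {x. x \<in> T \<or> \<not> P (insert x T)}"

definition obstruction_bound :: "nat \<Rightarrow> nat \<Rightarrow> nat \<Rightarrow> nat" where
  "obstruction_bound t m k = t + (t choose 2) * (m * k)"

lemma general_position_empty: "general_position \<L> {}"
  by (simp add: general_position_def)

lemma obstruction_bound_mono: "t \<le> t' \<Longrightarrow> obstruction_bound t m k \<le> obstruction_bound t' m k"
  unfolding obstruction_bound_def by (intro add_mono mult_le_mono1 binomial_right_mono)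

lemma card_UN_containing_le:
  assumes "finite H" "\<And>h. h \<in> H \<Longrightarrow> card (Q h) \<le> k" "bounded_codegree m H Q" "card s = 2"
  shows "card (\<Union>h\<in>{h \<in> H. s \<subseteq> Q h}. Q h) \<le> m * k"
proof -
  have "card (\<Union>h\<in>{h \<in> H. s \<subseteq> Q h}. Q h) \<le> (\<Sum>h\<in>{h \<in> H. s \<subseteq> Q h}. card (Q h))"
    using assms(1) by (intro card_UN_le) simp
  also have "\<dots> \<le> (\<Sum>h\<in>{h \<in> H. s \<subseteq> Q h}. k)" using assms(2) by (intro sum_mono) simp
  also have "\<dots> \<le> m * k" using assms(3,4) by (simp add: bounded_codegree_def codegree_def)
  finally show ?thesis .
qed

lemma obstructed_general_position_subset:
  assumes finT: "finite T" and gp: "general_position (Q ` H) T"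
  shows "obstructed (general_position (Q ` H)) T
    \<subseteq> T \<union> (\<Union>s\<in>{s. s \<subseteq> T \<and> card s = 2}. \<Union>h\<in>{h \<in> H. s \<subseteq> Q h}. Q h)" (is "_ \<subseteq> T \<union> ?cover")
proof -
  have "x \<in> ?cover" if x: "x \<notin> T" "\<not> general_position (Q ` H) (insert x T)" for x
  proof -
    obtain h where h: "h \<in> H" "2 < card (insert x T \<inter> Q h)"
      using x(2) by (auto simp: general_position_def not_le)
    have le_2: "card (T \<inter> Q h) \<le> 2" using gp h(1) by (simp add: general_position_def)
    then have x_Q: "x \<in> Q h" using h(2) by (cases "x \<in> Q h") auto
    then have "card (T \<inter> Q h) = 2" using le_2 h(2) x(1) finT by simp
    then show ?thesis using h(1) x_Q by auto
  qed
  then show ?thesis unfolding obstructed_def by blast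
qed

lemma obstructed_general_position:
  assumes finT: "finite T" and gp: "general_position (Q ` H) T" and finH: "finite H"
    and Q: "\<And>h. h \<in> H \<Longrightarrow> finite (Q h) \<and> card (Q h) \<le> k" and codeg: "bounded_codegree m H Q"
  shows "finite (obstructed (general_position (Q ` H)) T)" (is "finite ?F")
    and "card (obstructed (general_position (Q ` H)) T) \<le> obstruction_bound (card T) m k"
proof -
  let ?pairs = "{s. s \<subseteq> T \<and> card s = 2}"
  let ?cover = "\<Union>s\<in>?pairs. \<Union>h\<in>{h \<in> H. s \<subseteq> Q h}. Q h"
  have sub: "?F \<subseteq> T \<union> ?cover" by (rule obstructed_general_position_subset[OF finT gp])
  have fin_pairs: "finite ?pairs" using finT by simp
  then have fin_cover: "finite (T \<union> ?cover)" using finT finH Q by simp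
  show "finite ?F" using sub fin_cover by (rule finite_subset)
  have "card ?cover \<le> (\<Sum>s\<in>?pairs. card (\<Union>h\<in>{h \<in> H. s \<subseteq> Q h}. Q h))"
    by (rule card_UN_le[OF fin_pairs])
  also have "\<dots> \<le> (\<Sum>s\<in>?pairs. m * k)"
    using finH Q codeg by (intro sum_mono card_UN_containing_le) auto
  also have "\<dots> = (card T choose 2) * (m * k)" using n_subsets[OF finT, of 2] by simp
  finally show "card ?F \<le> obstruction_bound (card T) m k"
    using card_mono[OF fin_cover sub] card_Un_le[of T ?cover]
    unfolding obstruction_bound_def by linarith
qed

section \<open>Greedy embedding\<close>

lemma card_low_degree_le:
  fixes \<eta> d :: real
  assumes reg: "lower_regular \<eta> d R A B" and fin: "finite A" "finite B" and D: "D \<subseteq> B"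
    and large: "\<eta> * card B \<le> card D" and \<eta>: "0 \<le> \<eta>"
  shows "card {x \<in> A. card (R `` {x} \<inter> D) < d * card D} \<le> \<eta> * card A"
proof (rule ccontr)
  let ?L = "{x \<in> A. card (R `` {x} \<inter> D) < d * card D}"
  assume "\<not> ?thesis"
  then have large_L: "\<eta> * card A < card ?L" by simp
  moreover have "0 \<le> \<eta> * card A" using \<eta> by simp
  ultimately have "0 < real (card ?L)" by (rule le_less_trans[rotated])
  then have nonempty: "?L \<noteq> {}" by (metis card.empty less_irrefl of_nat_0)
  have finL: "finite ?L" and finD: "finite D" using fin D by (auto intro: finite_subset)
  have "d * (card ?L * card D) \<le> card (R \<inter> ?L \<times> D)"
    using large_L by (intro lower_regularD[OF reg _ D _ large]) auto
  also have "R \<inter> ?L \<times> D = (SIGMA x:?L. R `` {x} \<inter> D)" by auto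
  also have "real (card \<dots>) = (\<Sum>x\<in>?L. real (card (R `` {x} \<inter> D)))"
    using finL finD by (simp add: card_SigmaI)
  also have "\<dots> < (\<Sum>x\<in>?L. d * card D)"
    using finL nonempty by (intro sum_strict_mono) auto
  finally show False by (simp add: mult_ac)
qed

locale greedy_embedding =
  fixes V :: "'a set" and E :: "'a set set" and R :: "('v \<times> 'v) set" and A :: "'a \<Rightarrow> 'v set"
    and P :: "'v set \<Rightarrow> bool" and \<eta> d :: real and K :: nat
  assumes graph: "graph V E"
    and sym_R: "sym R"
    and finite_target: "u \<in> V \<Longrightarrow> finite (A u)"
    and regular: "{u, w} \<in> E \<Longrightarrow> lower_regular \<eta> d R (A u) (A w)"
    and \<eta>_nonneg: "0 \<le> \<eta>" and d_bounds: "0 \<le> d" "d \<le> 1"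
    and admissible_empty: "P {}"
    and obstruction: "\<lbrakk>finite T; card T < card V; P T\<rbrakk> \<Longrightarrow>
      finite (obstructed P T) \<and> card (obstructed P T) \<le> K"
    and room: "u \<in> V \<Longrightarrow> K < (d ^ card V - card V * \<eta>) * card (A u)"
begin

definition candidates :: "('a \<Rightarrow> 'v) \<Rightarrow> 'a set \<Rightarrow> 'a \<Rightarrow> 'v set" where
  "candidates \<phi> S u = {y \<in> A u. \<forall>w\<in>S. {w, u} \<in> E \<longrightarrow> (\<phi> w, y) \<in> R}"

definition partial_embedding :: "('a \<Rightarrow> 'v) \<Rightarrow> 'a set \<Rightarrow> bool" where
  "partial_embedding \<phi> S \<longleftrightarrow> inj_on \<phi> S \<and> (\<forall>u\<in>S. \<phi> u \<in> A u) \<and>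
     (\<forall>u\<in>S. \<forall>w\<in>S. {u, w} \<in> E \<longrightarrow> (\<phi> u, \<phi> w) \<in> R) \<and> P (\<phi> ` S) \<and>
     (\<forall>u\<in>V - S. d ^ card S * card (A u) \<le> card (candidates \<phi> S u))"

lemma finite_V: "finite V"
  using graph by (simp add: graph_def)

lemma no_loop: "{u, u} \<notin> E"
  using graph by (auto simp: graph_def)

lemma candidates_insert:
  assumes "v \<notin> S"
  shows "candidates (\<phi>(v := x)) (insert v S) u =
    (if {v, u} \<in> E then R `` {x} \<inter> candidates \<phi> S u else candidates \<phi> S u)"
  using assms by (auto simp: candidates_def)

lemma partial_embedding_insert:
  assumes emb: "partial_embedding \<phi> S" and S: "finite S" "v \<notin> S"
    and x: "x \<in> candidates \<phi> S v" "x \<notin> \<phi> ` S" "P (insert x (\<phi> ` S))"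
    and degree: "\<And>u. \<lbrakk>u \<in> V - insert v S; {v, u} \<in> E\<rbrakk> \<Longrightarrow>
      d * card (candidates \<phi> S u) \<le> card (R `` {x} \<inter> candidates \<phi> S u)"
  shows "partial_embedding (\<phi>(v := x)) (insert v S)" (is "partial_embedding ?\<psi> _")
proof -
  have inj: "inj_on \<phi> S" and target: "\<And>u. u \<in> S \<Longrightarrow> \<phi> u \<in> A u"
    and hom: "\<And>u w. \<lbrakk>u \<in> S; w \<in> S; {u, w} \<in> E\<rbrakk> \<Longrightarrow> (\<phi> u, \<phi> w) \<in> R"
    and many: "\<And>u. u \<in> V - S \<Longrightarrow> d ^ card S * card (A u) \<le> card (candidates \<phi> S u)"
    using emb by (simp_all add: partial_embedding_def)
  have x_edge: "(\<phi> w, x) \<in> R" "(x, \<phi> w) \<in> R" if "w \<in> S" "{w, v} \<in> E" for w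
    using x(1) that symD[OF sym_R] by (auto simp: candidates_def)
  have img: "?\<psi> ` insert v S = insert x (\<phi> ` S)" using S(2) by auto
  have "inj_on ?\<psi> (insert v S)"
    using inj_on_fun_updI[OF inj x(2)] x(2) S(2) by auto
  moreover have "\<forall>u\<in>insert v S. ?\<psi> u \<in> A u"
    using target x(1) by (auto simp: candidates_def)
  moreover have "\<forall>u\<in>insert v S. \<forall>w\<in>insert v S. {u, w} \<in> E \<longrightarrow> (?\<psi> u, ?\<psi> w) \<in> R"
    using hom x_edge no_loop S(2) by (auto simp: insert_commute)
  moreover have "\<forall>u\<in>V - insert v S.
      d ^ card (insert v S) * card (A u) \<le> card (candidates ?\<psi> (insert v S) u)"
  proof
    fix u assume u: "u \<in> V - insert v S"
    have "d ^ card S * card (A u) \<le> card (candidates \<phi> S u)"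
      using u by (intro many) simp
    then have "d ^ card (insert v S) * card (A u) \<le> d * card (candidates \<phi> S u)"
      using S d_bounds(1) by (simp add: mult.assoc mult_left_mono)
    also have "\<dots> \<le> card (candidates ?\<psi> (insert v S) u)"
      using degree[OF u] d_bounds mult_left_le_one_le[of "real (card (candidates \<phi> S u))" d]
      by (simp add: candidates_insert[OF S(2)])
    finally show "d ^ card (insert v S) * card (A u) \<le> card (candidates ?\<psi> (insert v S) u)" .
  qed
  ultimately show ?thesis
    unfolding partial_embedding_def img using x(3) by blast
qed

lemma card_candidates_ge:
  assumes "partial_embedding \<phi> S" "S \<subseteq> V" "u \<in> V - S"
  shows "d ^ card V * card (A u) \<le> card (candidates \<phi> S u)"
proof -
  have "d ^ card V \<le> d ^ card S"
    using assms(2) finite_V d_bounds by (intro power_decreasing card_mono) auto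
  then have "d ^ card V * card (A u) \<le> d ^ card S * card (A u)"
    by (intro mult_right_mono) auto
  also have "\<dots> \<le> card (candidates \<phi> S u)"
    using assms(1,3) by (simp add: partial_embedding_def)
  finally show ?thesis .
qed

lemma \<eta>_le_power:
  assumes "u \<in> V"
  shows "\<eta> \<le> d ^ card V"
proof -
  have "0 < (d ^ card V - card V * \<eta>) * card (A u)"
    using room[OF assms] by linarith
  then have "card V * \<eta> < d ^ card V"
    by (simp add: zero_less_mult_iff)
  moreover have "1 * \<eta> \<le> card V * \<eta>"
    using finite_V assms \<eta>_nonneg by (intro mult_right_mono) (auto simp: Suc_le_eq card_gt_0_iff)
  ultimately show ?thesis by simp
qed

lemma card_low_degree_candidates_le:
  assumes emb: "partial_embedding \<phi> S" and S: "S \<subseteq> V" and u: "u \<in> V - S" and edge: "{v, u} \<in> E"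
  shows "card {x \<in> A v. card (R `` {x} \<inter> candidates \<phi> S u) < d * card (candidates \<phi> S u)}
    \<le> \<eta> * card (A v)"
proof (rule card_low_degree_le[OF regular[OF edge]])
  have v: "v \<in> V" using graph edge by (auto simp: graph_def)
  then show "finite (A v)" "finite (A u)" using u finite_target by auto
  have "\<eta> * card (A u) \<le> d ^ card V * card (A u)"
    by (intro mult_right_mono \<eta>_le_power[OF v]) simp
  also have "\<dots> \<le> card (candidates \<phi> S u)" by (rule card_candidates_ge[OF emb S u])
  finally show "\<eta> * card (A u) \<le> card (candidates \<phi> S u)" .
qed (auto simp: candidates_def \<eta>_nonneg)

lemma ex_admissible_candidate:
  assumes emb: "partial_embedding \<phi> S" and S: "S \<subseteq> V" and v: "v \<in> V - S"
  obtains x where "x \<in> candidates \<phi> S v" "x \<notin> \<phi> ` S" "P (insert x (\<phi> ` S))"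
    "\<And>u. \<lbrakk>u \<in> V - insert v S; {v, u} \<in> E\<rbrakk> \<Longrightarrow>
      d * card (candidates \<phi> S u) \<le> card (R `` {x} \<inter> candidates \<phi> S u)"
proof -
  let ?forbidden = "obstructed P (\<phi> ` S)"
  define N where "N = {u \<in> V - insert v S. {v, u} \<in> E}"
  define low where
    "low u = {x \<in> A v. card (R `` {x} \<inter> candidates \<phi> S u) < d * card (candidates \<phi> S u)}" for u
  have finS: "finite S" using S finite_V finite_subset by blast
  have finN: "finite N" and cardN: "card N \<le> card V"
    using finite_V by (auto simp: N_def intro!: card_mono)
  have "card (\<phi> ` S) < card V"
    using card_image_le[OF finS, of \<phi>] psubset_card_mono[OF finite_V, of S] S v by force
  then have forbidden: "finite ?forbidden" "card ?forbidden \<le> K"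
    using obstruction[of "\<phi> ` S"] emb finS by (auto simp: partial_embedding_def)
  have "card ((\<Union>u\<in>N. low u) \<union> ?forbidden) \<le> (\<Sum>u\<in>N. card (low u)) + card ?forbidden"
    using card_Un_le[of "\<Union>u\<in>N. low u" ?forbidden] card_UN_le[OF finN, of low] by linarith
  then have "real (card ((\<Union>u\<in>N. low u) \<union> ?forbidden))
      \<le> (\<Sum>u\<in>N. real (card (low u))) + card ?forbidden"
    by (metis of_nat_add of_nat_le_iff of_nat_sum)
  also have "\<dots> \<le> (\<Sum>u\<in>N. \<eta> * card (A v)) + K"
    using card_low_degree_candidates_le[OF emb S] forbidden(2)
    by (intro add_mono sum_mono) (auto simp: N_def low_def)
  also have "\<dots> \<le> card V * (\<eta> * card (A v)) + K"
    using cardN \<eta>_nonneg by (simp add: mult_right_mono)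
  also have "\<dots> < d ^ card V * card (A v)"
    using room[of v] v by (simp add: algebra_simps)
  also have "\<dots> \<le> card (candidates \<phi> S v)" by (rule card_candidates_ge[OF emb S v])
  finally have "card ((\<Union>u\<in>N. low u) \<union> ?forbidden) < card (candidates \<phi> S v)" by simp
  moreover have "finite ((\<Union>u\<in>N. low u) \<union> ?forbidden)"
    using finN forbidden(1) finite_target v by (auto simp: low_def)
  ultimately have "\<not> candidates \<phi> S v \<subseteq> (\<Union>u\<in>N. low u) \<union> ?forbidden"
    using card_mono by (metis not_le)
  then obtain x where x: "x \<in> candidates \<phi> S v" "\<And>u. u \<in> N \<Longrightarrow> x \<notin> low u" "x \<notin> ?forbidden" by blast
  show thesis
  proof (rule that[OF x(1)])
    show "d * card (candidates \<phi> S u) \<le> card (R `` {x} \<inter> candidates \<phi> S u)"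
      if "u \<in> V - insert v S" "{v, u} \<in> E" for u
      using x(1) x(2)[of u] that by (auto simp: N_def low_def candidates_def not_less)
  qed (use x(3) in \<open>auto simp: obstructed_def\<close>)
qed

lemma ex_embedding:
  obtains \<phi> where "inj_on \<phi> V" "\<And>u. u \<in> V \<Longrightarrow> \<phi> u \<in> A u"
    "\<And>u w. {u, w} \<in> E \<Longrightarrow> (\<phi> u, \<phi> w) \<in> R" "P (\<phi> ` V)"
proof -
  have "\<exists>\<phi>. partial_embedding \<phi> S" if "finite S" "S \<subseteq> V" for S
    using that
  proof (induction S rule: finite_induct)
    case empty
    show ?case
      by (simp add: partial_embedding_def candidates_def admissible_empty)
  next
    case (insert v S)
    then obtain \<phi> where emb: "partial_embedding \<phi> S" by blast
    obtain x where "x \<in> candidates \<phi> S v" "x \<notin> \<phi> ` S" "P (insert x (\<phi> ` S))"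
      "\<And>u. \<lbrakk>u \<in> V - insert v S; {v, u} \<in> E\<rbrakk> \<Longrightarrow>
        d * card (candidates \<phi> S u) \<le> card (R `` {x} \<inter> candidates \<phi> S u)"
      using ex_admissible_candidate[OF emb, of v] insert.prems insert.hyps by blast
    then show ?case
      using partial_embedding_insert[OF emb insert.hyps] by blast
  qed
  from this[OF finite_V order_refl] obtain \<phi> where "partial_embedding \<phi> V" by blast
  moreover have "u \<in> V" "w \<in> V" if "{u, w} \<in> E" for u w
    using that graph by (auto simp: graph_def)
  ultimately show thesis
    by (intro that[of \<phi>]) (auto simp: partial_embedding_def)
qed

end

section \<open>Colourings and Ramsey numbers\<close>

lemma finite_graph_edges: "graph V E \<Longrightarrow> finite E"
  by (rule finite_subset[of _ "Pow V"]) (auto simp: graph_def)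

lemma graph_subset_edges: "graph V E \<Longrightarrow> E' \<subseteq> E \<Longrightarrow> graph V E'"
  by (auto simp: graph_def)

lemma graph_edgeE:
  assumes "graph V E" "a \<in> E"
  obtains u w where "a = {u, w}" "u \<noteq> w" "u \<in> V" "w \<in> V"
  using assms by (auto simp: graph_def card_2_iff)

lemma graph_complete: "graph {0..<k} (complete_graph_edges k)"
  by (auto simp: graph_def complete_graph_edges_def)

lemma ex_colouring_chromatic_number:
  assumes "graph V E"
  obtains c where "c ` V \<subseteq> {0..<chromatic_number V E}" "\<And>a. a \<in> E \<Longrightarrow> inj_on c a"
proof -
  let ?P = "\<lambda>k. \<exists>c. c ` V \<subseteq> {0..<k} \<and> (\<forall>e\<in>E. \<forall>u\<in>e. \<forall>v\<in>e. u \<noteq> v \<longrightarrow> c u \<noteq> c v)"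
  have "finite V" and edges: "\<And>a. a \<in> E \<Longrightarrow> a \<subseteq> V" using assms by (auto simp: graph_def)
  then obtain c where c: "bij_betw c V {0..<card V}" using ex_bij_betw_finite_nat by blast
  then have "?P (card V)"
    using edges by (intro exI[of _ c]) (auto simp: bij_betw_def inj_on_def subset_iff)
  then have "?P (chromatic_number V E)"
    unfolding chromatic_number_def by (rule LeastI)
  then obtain c where c: "c ` V \<subseteq> {0..<chromatic_number V E}"
    "\<forall>e\<in>E. \<forall>u\<in>e. \<forall>v\<in>e. u \<noteq> v \<longrightarrow> c u \<noteq> c v"
    by (elim exE conjE)
  show thesis
    by (rule that[OF c(1)]) (use c(2) in \<open>unfold inj_on_def, blast\<close>)
qed

lemma ex_colouring_onto:
  assumes "graph V E" "finite C" "card C = chromatic_number V E"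
  obtains c where "c ` V \<subseteq> C" "\<And>a. a \<in> E \<Longrightarrow> inj_on c a"
proof -
  obtain c where c: "c ` V \<subseteq> {0..<chromatic_number V E}" "\<And>a. a \<in> E \<Longrightarrow> inj_on c a"
    using ex_colouring_chromatic_number[OF assms(1)] by blast
  obtain f where f: "bij_betw f {0..<chromatic_number V E} C"
    using ex_bij_betw_nat_finite[OF assms(2)] assms(3) by auto
  show thesis
  proof (rule that[of "f \<circ> c"])
    show "(f \<circ> c) ` V \<subseteq> C" using c(1) f by (auto simp: bij_betw_def)
    show "inj_on (f \<circ> c) a" if "a \<in> E" for a
    proof (rule comp_inj_on[OF c(2)[OF that]])
      have "c ` a \<subseteq> {0..<chromatic_number V E}"
        using assms(1) that c(1) unfolding graph_def by (meson image_mono order_trans)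
      then show "inj_on f (c ` a)" using f inj_on_subset by (auto simp: bij_betw_def)
    qed
  qed
qed

lemma two_le_chromatic_number:
  assumes "graph V E" "a \<in> E"
  shows "2 \<le> chromatic_number V E"
proof -
  obtain c where c: "c ` V \<subseteq> {0..<chromatic_number V E}" "inj_on c a"
    using ex_colouring_chromatic_number[OF assms(1)] assms(2) by metis
  have "a \<subseteq> V" "card a = 2" using assms by (auto simp: graph_def)
  then have "2 = card (c ` a)" using c(2) by (simp add: card_image)
  also have "\<dots> \<le> card {0..<chromatic_number V E}"
    using c(1) \<open>a \<subseteq> V\<close> by (intro card_mono) auto
  finally show ?thesis by simp
qed

lemma coloured_copy_if_monochromatic:
  assumes g: "graph V E" and S: "S \<subseteq> {0..<N}" "card S = card V"
    and mono: "\<And>s. s \<subseteq> S \<Longrightarrow> card s = 2 \<Longrightarrow> col s = b"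
  shows "coloured_copy N col b V E"
proof -
  have "finite V" "finite S" using g S(1) finite_subset by (auto simp: graph_def)
  then obtain \<phi> where \<phi>: "bij_betw \<phi> V S" using S(2) by (metis finite_same_card_bij)
  have "col (\<phi> ` a) = b" if "a \<in> E" for a
  proof (rule mono)
    have a: "a \<subseteq> V" "card a = 2" using g that by (auto simp: graph_def)
    then show "\<phi> ` a \<subseteq> S" using \<phi> by (auto simp: bij_betw_def)
    show "card (\<phi> ` a) = 2"
      using a \<phi> by (metis bij_betw_def card_image inj_on_subset)
  qed
  then show ?thesis
    unfolding coloured_copy_def using \<phi> S(1) by (intro exI[of _ \<phi>]) (auto simp: bij_betw_def)
qed

lemma coloured_copy_ramsey_number:
  assumes "graph VH EH" "graph VG EG"
  shows "coloured_copy (ramsey_number VH EH VG EG) col False VH EH \<or>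
    coloured_copy (ramsey_number VH EH VG EG) col True VG EG"
proof -
  obtain N :: nat where N: "\<And>(X :: nat set) F. finite X \<Longrightarrow> N \<le> card X \<Longrightarrow>
      \<exists>S\<subseteq>X. card S = card VG \<and> clique S F \<or> card S = card VH \<and> indep S F"
    using ramsey2[of "card VG" "card VH"] by metis
  have "coloured_copy N col False VH EH \<or> coloured_copy N col True VG EG" for col
  proof -
    obtain S where S: "S \<subseteq> {0..<N}"
      and "card S = card VG \<and> clique S {s. col s} \<or> card S = card VH \<and> indep S {s. col s}"
      using N[of "{0..<N}" "{s. col s}"] by auto
    then consider "card S = card VG" "clique S {s. col s}" | "card S = card VH" "indep S {s. col s}"
      by blast
    then show ?thesis
    proof cases
      case 1
      then have "coloured_copy N col True VG EG"
        by (intro coloured_copy_if_monochromatic[OF assms(2) S]) (auto simp: clique_def card_2_iff)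
      then show ?thesis ..
    next
      case 2
      then have "coloured_copy N col False VH EH"
        by (intro coloured_copy_if_monochromatic[OF assms(1) S]) (auto simp: indep_def card_2_iff)
      then show ?thesis ..
    qed
  qed
  then have "\<exists>N. \<forall>col. coloured_copy N col False VH EH \<or> coloured_copy N col True VG EG"
    by blast
  then show ?thesis unfolding ramsey_number_def by (rule LeastI2_ex) blast
qed

lemma coloured_copy_transfer:
  assumes copy: "coloured_copy N (\<lambda>s. col (\<iota> ` s)) b V E"
    and \<iota>: "inj_on \<iota> {0..<N}" "\<iota> ` {0..<N} \<subseteq> S"
  shows "\<exists>\<phi>. inj_on \<phi> V \<and> \<phi> ` V \<subseteq> S \<and> (\<forall>a\<in>E. col (\<phi> ` a) = b)"
proof -
  obtain \<phi> where \<phi>: "inj_on \<phi> V" "\<phi> ` V \<subseteq> {0..<N}" "\<forall>a\<in>E. col (\<iota> ` \<phi> ` a) = b"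
    using copy by (auto simp: coloured_copy_def)
  have "inj_on (\<iota> \<circ> \<phi>) V" using \<phi>(1,2) \<iota>(1) by (auto intro: comp_inj_on inj_on_subset)
  moreover have "(\<iota> \<circ> \<phi>) ` V \<subseteq> S" using \<phi>(2) \<iota>(2) by auto
  ultimately show ?thesis using \<phi>(3) by (intro exI[of _ "\<iota> \<circ> \<phi>"]) (simp add: image_comp)
qed

lemma ramsey_number_le_cardE:
  assumes g: "graph VH EH" "graph VG EG"
    and S: "finite S" "ramsey_number VH EH VG EG \<le> card S"
  obtains (blue) \<phi> where "inj_on \<phi> VH" "\<phi> ` VH \<subseteq> S" "\<And>a. a \<in> EH \<Longrightarrow> \<not> col (\<phi> ` a)"
  | (red) \<phi> where "inj_on \<phi> VG" "\<phi> ` VG \<subseteq> S" "\<And>a. a \<in> EG \<Longrightarrow> col (\<phi> ` a)"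
proof -
  let ?N = "ramsey_number VH EH VG EG"
  obtain \<iota> where "bij_betw \<iota> {0..<card S} S" using ex_bij_betw_nat_finite[OF S(1)] by blast
  then have \<iota>: "inj_on \<iota> {0..<?N}" "\<iota> ` {0..<?N} \<subseteq> S"
    using S(2) by (auto simp: bij_betw_def intro: inj_on_subset)
  from coloured_copy_ramsey_number[OF g, of "\<lambda>s. col (\<iota> ` s)"] show thesis
  proof
    assume "coloured_copy ?N (\<lambda>s. col (\<iota> ` s)) False VH EH"
    from coloured_copy_transfer[OF this \<iota>] show thesis using blue by auto
  next
    assume "coloured_copy ?N (\<lambda>s. col (\<iota> ` s)) True VG EG"
    from coloured_copy_transfer[OF this \<iota>] show thesis using red by auto
  qed
qed

section \<open>Berge copies\<close>

lemma ex_distinct_representatives: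
  assumes "finite I" "card I \<le> n" "\<And>i. i \<in> I \<Longrightarrow> n \<le> card (F i)"
  shows "\<exists>f. inj_on f I \<and> (\<forall>i\<in>I. f i \<in> F i)"
  using assms
proof (induction I rule: finite_induct)
  case empty
  show ?case by simp
next
  case (insert i I)
  then obtain f where f: "inj_on f I" "\<forall>j\<in>I. f j \<in> F j" by fastforce
  have "card (f ` I) < card (F i)"
    using insert.prems(1) insert.prems(2)[of i] insert.hyps card_image[OF f(1)] by simp
  then have "\<not> F i \<subseteq> f ` I" using insert.hyps card_mono[of "f ` I" "F i"] by auto
  then obtain y where y: "y \<in> F i" "y \<notin> f ` I" by blast
  have "inj_on (f(i := y)) (insert i I)"
    using inj_on_fun_updI[OF f(1) y(2)] y(2) insert.hyps(2) by auto
  moreover have "\<forall>j\<in>insert i I. (f(i := y)) j \<in> F j" using f(2) y(1) by auto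
  ultimately show ?case by blast
qed

lemma contains_berge_if_high_codegree:
  assumes g: "graph V E" and e: "e \<in> E" and h: "h \<in> H" "h \<subseteq> {0..<n}"
    and \<psi>: "inj_on \<psi> V" "\<psi> ` V \<subseteq> h"
    and codeg: "\<And>a. a \<in> E - {e} \<Longrightarrow> card E \<le> codegree H id (\<psi> ` a)"
  shows "contains_berge V E n H"
proof -
  have finE: "finite E" using g by (rule finite_graph_edges)
  have "\<exists>f. inj_on f (E - {e}) \<and> (\<forall>a\<in>E - {e}. f a \<in> {h' \<in> H. \<psi> ` a \<subseteq> h'} - {h})"
  proof (rule ex_distinct_representatives)
    show "card (E - {e}) \<le> card E - 1" using finE e by simp
    fix a assume "a \<in> E - {e}"
    then have "card E - 1 \<le> card {h' \<in> H. \<psi> ` a \<subseteq> h'} - 1"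
      using codeg by (simp add: codegree_def diff_le_mono)
    also have "\<dots> \<le> card ({h' \<in> H. \<psi> ` a \<subseteq> h'} - {h})"
      using diff_card_le_card_Diff[of "{h}"] by simp
    finally show "card E - 1 \<le> card ({h' \<in> H. \<psi> ` a \<subseteq> h'} - {h})" .
  qed (use finE in simp)
  then obtain f where f: "inj_on f (E - {e})"
    "\<And>a. a \<in> E - {e} \<Longrightarrow> f a \<in> H \<and> \<psi> ` a \<subseteq> f a \<and> f a \<noteq> h"
    by auto
  let ?f = "f(e := h)"
  have "inj_on ?f E"
  proof (rule inj_onI)
    fix a b assume "a \<in> E" "b \<in> E" "?f a = ?f b"
    then show "a = b"
      using f(2)[of a] f(2)[of b] inj_onD[OF f(1), of a b] by (auto split: if_splits)
  qed
  moreover have "?f ` E \<subseteq> H" using f(2) h(1) by auto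
  moreover have "\<forall>a\<in>E. \<psi> ` a \<subseteq> ?f a"
  proof
    have "\<psi> ` e \<subseteq> h" using \<psi>(2) g e by (auto simp: graph_def)
    then show "\<psi> ` a \<subseteq> ?f a" if "a \<in> E" for a using f(2)[of a] that by simp
  qed
  ultimately show ?thesis
    unfolding contains_berge_def using \<psi> h(2) by (intro exI[of _ \<psi>] exI[of _ ?f]) auto
qed

lemma ex_low_codegree_clique:
  assumes g: "graph V E" and e: "e \<in> E" and h: "h \<in> H" "h \<subseteq> {0..<n}"
    and r: "ramsey_number {0..<k} (complete_graph_edges k) V (E - {e}) \<le> card h"
    and free: "\<not> contains_berge V E n H"
  shows "\<exists>q\<subseteq>h. card q = k \<and> (\<forall>s\<subseteq>q. card s = 2 \<longrightarrow> codegree H id s < card E)"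
proof -
  have finh: "finite h" using h(2) finite_subset by blast
  have g': "graph V (E - {e})" using graph_subset_edges[OF g] by blast
  from graph_complete g' finh r show ?thesis
  proof (cases rule: ramsey_number_le_cardE[where col = "\<lambda>s. card E \<le> codegree H id s"])
    case (blue \<phi>)
    have "codegree H id s < card E" if s: "s \<subseteq> \<phi> ` {0..<k}" "card s = 2" for s
    proof -
      obtain a where a: "a \<subseteq> {0..<k}" "s = \<phi> ` a" using s(1) by (rule subset_imageE)
      then have "card a = 2"
        using s(2) blue(1) by (metis card_image inj_on_subset)
      then show ?thesis
        using blue(3)[of a] a by (simp add: complete_graph_edges_def)
    qed
    then show ?thesis
      using blue(1,2) by (intro exI[of _ "\<phi> ` {0..<k}"]) (simp add: card_image)
  next
    case (red \<phi>)
    then have "contains_berge V E n H"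
      by (intro contains_berge_if_high_codegree[OF g e h]) auto
    then show ?thesis using free by contradiction
  qed
qed

lemma contains_berge_if_general_position:
  assumes g: "graph V E" and \<phi>: "inj_on \<phi> V" "\<phi> ` V \<subseteq> {0..<n}"
    and Q: "\<And>h. h \<in> H \<Longrightarrow> Q h \<subseteq> h"
    and edges: "\<And>u w. {u, w} \<in> E \<Longrightarrow> (\<phi> u, \<phi> w) \<in> shadow H Q"
    and gp: "general_position (Q ` H) (\<phi> ` V)"
  shows "contains_berge V E n H"
proof -
  have "\<exists>h\<in>H. \<phi> ` a \<subseteq> Q h" if "a \<in> E" for a
  proof -
    obtain u w where "a = {u, w}" using g \<open>a \<in> E\<close> by (rule graph_edgeE)
    then show ?thesis using edges[of u w] that by (auto simp: shadow_def)
  qed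
  then obtain f where f: "\<And>a. a \<in> E \<Longrightarrow> f a \<in> H \<and> \<phi> ` a \<subseteq> Q (f a)" by metis
  have "inj_on f E"
  proof (rule inj_onI)
    fix a b assume ab: "a \<in> E" "b \<in> E" "f a = f b"
    have V: "a \<union> b \<subseteq> V" "finite V" and card2: "card a = 2" "card b = 2"
      using g ab(1,2) by (auto simp: graph_def)
    then have fin: "finite (a \<union> b)" using finite_subset by blast
    have "card (a \<union> b) = card (\<phi> ` (a \<union> b))"
      using \<phi>(1) V(1) by (metis card_image inj_on_subset)
    also have "\<dots> \<le> card (\<phi> ` V \<inter> Q (f a))"
      using f[OF ab(1)] f[OF ab(2)] ab(3) V by (intro card_mono) auto
    also have "\<dots> \<le> 2" using gp f[OF ab(1)] by (simp add: general_position_def)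
    finally have "card (a \<union> b) \<le> 2" .
    then have "a = a \<union> b" "b = a \<union> b"
      using card2 by (intro card_seteq[OF fin]; simp)+
    then show "a = b" by simp
  qed
  moreover have "f ` E \<subseteq> H" "\<forall>a\<in>E. \<phi> ` a \<subseteq> f a" using f Q by blast+
  ultimately show ?thesis unfolding contains_berge_def using \<phi> by blast
qed

lemma ex_greedy_parameters:
  fixes b d :: real
  assumes d: "0 < d" "d \<le> 1" and v: "0 < v"
  obtains \<eta> :: real and L :: nat where "0 < \<eta>" "\<eta> \<le> d" "b < (d ^ v - v * \<eta>) * L"
proof -
  obtain L :: nat where L: "b < L * (d ^ v / 2)"
    using reals_Archimedean3[of "d ^ v / 2"] d(1) by auto
  define \<eta> where "\<eta> = d ^ v / (2 * v)"
  have "0 < \<eta>" and half: "d ^ v - v * \<eta> = d ^ v / 2" using d(1) v by (simp_all add: \<eta>_def)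
  have "\<eta> \<le> d ^ v / 1" unfolding \<eta>_def using d(1) v by (intro divide_left_mono) auto
  also have "\<dots> \<le> d" using power_decreasing[of 1 v d] d v by simp
  finally have "\<eta> \<le> d" .
  have "b < (d ^ v - v * \<eta>) * L" unfolding half using L by (simp add: mult.commute)
  then show thesis by (rule that[OF \<open>0 < \<eta>\<close> \<open>\<eta> \<le> d\<close>])
qed

lemma greedy_embedding_regular_blowup:
  fixes \<eta> d :: real
  assumes g: "graph V E" and finH: "finite H" and finX: "finite X"
    and Q: "\<And>h. h \<in> H \<Longrightarrow> finite (Q h) \<and> card (Q h) \<le> k" and codeg: "bounded_codegree m H Q"
    and blowup: "regular_blowup \<eta> d L X (shadow H Q) q A"
    and c: "c ` V \<subseteq> q" "\<And>a. a \<in> E \<Longrightarrow> inj_on c a"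
    and \<eta>: "0 \<le> \<eta>" and d: "0 \<le> d" "d \<le> 1"
    and L: "obstruction_bound (card V) m k < (d ^ card V - card V * \<eta>) * L"
  shows "greedy_embedding V E (shadow H Q) (\<lambda>u. A (c u)) (general_position (Q ` H)) \<eta> d
    (obstruction_bound (card V) m k)"
proof
  have A: "A (c u) \<subseteq> X" "L \<le> card (A (c u))" if "u \<in> V" for u
    using blowup c(1) that by (auto simp: regular_blowup_def)
  show "finite (A (c u))" if "u \<in> V" for u
    using A(1)[OF that] finX by (rule finite_subset)
  show "lower_regular \<eta> d (shadow H Q) (A (c u)) (A (c w))" if "{u, w} \<in> E" for u w
  proof -
    have "u \<in> V" "w \<in> V" "card {u, w} = 2" using g that by (auto simp: graph_def)
    then have "c u \<in> q" "c w \<in> q" "c u \<noteq> c w"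
      using c(1) c(2)[OF that] by (auto simp: inj_on_eq_iff)
    then show ?thesis using blowup by (simp add: regular_blowup_def)
  qed
  show "finite (obstructed (general_position (Q ` H)) T) \<and>
    card (obstructed (general_position (Q ` H)) T) \<le> obstruction_bound (card V) m k"
    if T: "finite T" "card T < card V" "general_position (Q ` H) T" for T
    using obstructed_general_position[OF T(1,3) finH Q codeg]
      obstruction_bound_mono[of "card T" "card V" m k] T(2) by simp
  show "obstruction_bound (card V) m k < (d ^ card V - card V * \<eta>) * card (A (c u))"
    if u: "u \<in> V" for u
  proof -
    have "0 < (d ^ card V - card V * \<eta>) * L" using L by linarith
    then have "0 < d ^ card V - card V * \<eta>" by (simp add: zero_less_mult_iff)
    then have "(d ^ card V - card V * \<eta>) * L \<le> (d ^ card V - card V * \<eta>) * card (A (c u))"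
      using A(2)[OF u] by (intro mult_left_mono) auto
    then show ?thesis using L by linarith
  qed
qed (fact g sym_shadow \<eta> d general_position_empty)+

lemma contains_berge_if_regular_blowup:
  fixes \<eta> d :: real
  assumes g: "graph V E" and H: "\<Union>H \<subseteq> {0..<n}"
    and Q: "\<forall>h\<in>H. Q h \<subseteq> h \<and> card (Q h) = chromatic_number V E"
    and codeg: "bounded_codegree m H Q" and h: "h \<in> H"
    and blowup: "regular_blowup \<eta> d L {0..<n} (shadow H Q) (Q h) A"
    and \<eta>: "0 \<le> \<eta>" and d: "0 \<le> d" "d \<le> 1"
    and L: "obstruction_bound (card V) m (chromatic_number V E)
      < (d ^ card V - card V * \<eta>) * L"
  shows "contains_berge V E n H"
proof -
  have fin_Q: "finite (Q h) \<and> card (Q h) \<le> chromatic_number V E" if "h \<in> H" for h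
  proof -
    have "Q h \<subseteq> {0..<n}" using Q H that by blast
    then have "finite (Q h)" by (rule finite_subset) simp
    then show ?thesis using Q that by simp
  qed
  have finH: "finite H" using H by (intro finite_UnionD) (rule finite_subset, auto)
  obtain c where c: "c ` V \<subseteq> Q h" "\<And>a. a \<in> E \<Longrightarrow> inj_on c a"
    using ex_colouring_onto[OF g] fin_Q[OF h] Q h by (metis (no_types))
  interpret greedy_embedding V E "shadow H Q" "\<lambda>u. A (c u)" "general_position (Q ` H)" \<eta> d
    "obstruction_bound (card V) m (chromatic_number V E)"
    by (rule greedy_embedding_regular_blowup[OF g finH _ fin_Q codeg blowup c \<eta> d L]) simp
  obtain \<phi> where \<phi>: "inj_on \<phi> V" "\<And>u. u \<in> V \<Longrightarrow> \<phi> u \<in> A (c u)"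
    "\<And>u w. {u, w} \<in> E \<Longrightarrow> (\<phi> u, \<phi> w) \<in> shadow H Q" "general_position (Q ` H) (\<phi> ` V)"
    by (rule ex_embedding) blast
  have "A (c u) \<subseteq> {0..<n}" if "u \<in> V" for u
    using blowup c(1) that by (auto simp: regular_blowup_def)
  then have "\<phi> ` V \<subseteq> {0..<n}" using \<phi>(2) by blast
  moreover have "Q h \<subseteq> h" if "h \<in> H" for h using Q that by simp
  ultimately show ?thesis by (rule contains_berge_if_general_position[OF g \<phi>(1) _ _ \<phi>(3,4)])
qed

lemma eventually_contains_berge_if_many_cliques:
  fixes \<epsilon> :: real
  assumes g: "graph V E" and a: "a \<in> E" and \<epsilon>: "0 < \<epsilon>" and m: "0 < m"
  shows "\<forall>\<^sub>F n in sequentially. \<forall>H Q. \<Union>H \<subseteq> {0..<n} \<and>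
    (\<forall>h\<in>H. Q h \<subseteq> h \<and> card (Q h) = chromatic_number V E) \<and> bounded_codegree m H Q \<and>
    \<epsilon> * (real n)\<^sup>2 < card H \<longrightarrow> contains_berge V E n H"
proof -
  have "V \<noteq> {}" "finite V" using g a by (auto simp: graph_def)
  then have V_pos: "0 < card V" by (simp add: card_gt_0_iff)
  define d where "d = min 1 (\<epsilon> / (4 * m))"
  have d: "0 < d" "d \<le> 1" using \<epsilon> m by (simp_all add: d_def)
  have "d \<le> \<epsilon> / (4 * m)" by (simp add: d_def)
  then have d\<epsilon>: "4 * d * m \<le> \<epsilon>" using m by (simp add: pos_le_divide_eq mult_ac)
  let ?K = "obstruction_bound (card V) m (chromatic_number V E)"
  obtain \<eta> :: real and L :: nat where \<eta>: "0 < \<eta>" "\<eta> \<le> d"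
    and L: "real ?K < (d ^ card V - card V * \<eta>) * L"
    by (rule ex_greedy_parameters[OF d V_pos])
  show ?thesis
    using eventually_ex_regular_member[OF \<eta>(1) d(1), where m = m and L = L]
  proof (rule eventually_mono, intro allI impI, elim conjE)
    fix n :: nat and H :: "nat set set" and Q
    assume regular: "\<forall>(X :: nat set) (H :: nat set set) Q.
        finite X \<and> card X = n \<and> \<Union>(Q ` H) \<subseteq> X \<and> (\<forall>h\<in>H. 2 \<le> card (Q h)) \<and> bounded_codegree m H Q \<and>
        2 * (d + \<eta>) * m * (real n)\<^sup>2 < card H \<longrightarrow>
        (\<exists>h\<in>H. \<exists>A. regular_blowup \<eta> d L X (shadow H Q) (Q h) A)"
      and H: "\<Union>H \<subseteq> {0..<n}" and Q: "\<forall>h\<in>H. Q h \<subseteq> h \<and> card (Q h) = chromatic_number V E"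
      and codeg: "bounded_codegree m H Q" and big: "\<epsilon> * (real n)\<^sup>2 < card H"
    have "2 * (d + \<eta>) * m \<le> 4 * d * m" using \<eta>(2) by (intro mult_right_mono) auto
    then have "2 * (d + \<eta>) * m * (real n)\<^sup>2 \<le> \<epsilon> * (real n)\<^sup>2"
      using d\<epsilon> by (intro mult_right_mono) auto
    then have many: "2 * (d + \<eta>) * m * (real n)\<^sup>2 < card H" using big by linarith
    have Q2: "\<forall>h\<in>H. 2 \<le> card (Q h)" using two_le_chromatic_number[OF g a] Q by simp
    have "\<Union>(Q ` H) \<subseteq> {0..<n}" using H Q by blast
    then obtain h A where "h \<in> H" "regular_blowup \<eta> d L {0..<n} (shadow H Q) (Q h) A"
      using regular[rule_format, of "{0..<n}" Q H] Q2 codeg many by auto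
    then show "contains_berge V E n H"
      using contains_berge_if_regular_blowup[OF g H Q codeg _ _ _ _ d(2) L] \<eta>(1) d(1) by simp
  qed
qed

lemma bounded_codegree_if_low_codegree:
  assumes finH: "finite H" and Q: "\<And>h. h \<in> H \<Longrightarrow> Q h \<subseteq> h"
    and low: "\<And>h s. \<lbrakk>h \<in> H; s \<subseteq> Q h; card s = 2\<rbrakk> \<Longrightarrow> codegree H id s \<le> m"
  shows "bounded_codegree m H Q"
  unfolding bounded_codegree_def
proof (intro allI impI)
  fix s :: "'a set" assume s: "card s = 2"
  show "codegree H Q s \<le> m"
  proof (cases "\<exists>h\<in>H. s \<subseteq> Q h")
    case True
    have "codegree H Q s \<le> codegree H id s"
      unfolding codegree_def using finH Q by (intro card_mono) auto
    also have "\<dots> \<le> m" using True low s by blast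
    finally show ?thesis .
  next
    case False
    then have "{h \<in> H. s \<subseteq> Q h} = {}" by blast
    then show ?thesis unfolding codegree_def by (simp only: card.empty)
  qed
qed

lemma eventually_berge_free_card_le:
  fixes \<epsilon> :: real
  assumes g: "graph V E" and e: "e \<in> E" and \<epsilon>: "0 < \<epsilon>"
    and r: "ramsey_number {0..<chromatic_number V E} (complete_graph_edges (chromatic_number V E))
      V (E - {e}) \<le> r"
  shows "\<forall>\<^sub>F n in sequentially. \<forall>H. uniform_hypergraph r n H \<and> \<not> contains_berge V E n H \<longrightarrow>
    card H \<le> \<epsilon> * (real n)\<^sup>2"
proof -
  have "0 < card E" using finite_graph_edges[OF g] e by (auto simp: card_gt_0_iff)
  from eventually_contains_berge_if_many_cliques[OF g e \<epsilon> this] show ?thesis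
  proof (rule eventually_mono, intro allI impI, elim conjE)
    fix n H
    assume many: "\<forall>H Q. \<Union>H \<subseteq> {0..<n} \<and> (\<forall>h\<in>H. Q h \<subseteq> h \<and> card (Q h) = chromatic_number V E) \<and>
        bounded_codegree (card E) H Q \<and> \<epsilon> * (real n)\<^sup>2 < card H \<longrightarrow> contains_berge V E n H"
      and unif: "uniform_hypergraph r n H" and free: "\<not> contains_berge V E n H"
    have H: "\<Union>H \<subseteq> {0..<n}" "\<And>h. h \<in> H \<Longrightarrow> h \<subseteq> {0..<n} \<and> card h = r"
      using unif by (auto simp: uniform_hypergraph_def)
    have "\<exists>q\<subseteq>h. card q = chromatic_number V E \<and> (\<forall>s\<subseteq>q. card s = 2 \<longrightarrow> codegree H id s < card E)"
      if "h \<in> H" for h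
      using H(2)[OF that] r by (intro ex_low_codegree_clique[OF g e that _ _ free]) auto
    then obtain Q where Q: "\<forall>h\<in>H. Q h \<subseteq> h \<and> card (Q h) = chromatic_number V E"
      and low: "\<And>h s. \<lbrakk>h \<in> H; s \<subseteq> Q h; card s = 2\<rbrakk> \<Longrightarrow> codegree H id s < card E"
      by metis
    have "finite H" using H(1) by (intro finite_UnionD) (rule finite_subset, auto)
    then have "bounded_codegree (card E) H Q"
      using Q low by (intro bounded_codegree_if_low_codegree) (auto intro: less_imp_le)
    then show "card H \<le> \<epsilon> * (real n)\<^sup>2" using many H(1) Q free by (meson not_le)
  qed
qed

lemma ex_berge_attained:
  assumes "E \<noteq> {}"
  obtains H where "uniform_hypergraph r n H" "\<not> contains_berge V E n H" "card H = ex_berge r n V E"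
proof -
  let ?S = "{card H | H. uniform_hypergraph r n H \<and> \<not> contains_berge V E n H}"
  have "?S \<subseteq> card ` Pow (Pow {0..<n})" by (auto simp: uniform_hypergraph_def)
  then have "finite ?S" by (rule finite_subset) simp
  moreover have "uniform_hypergraph r n {}" "\<not> contains_berge V E n {}"
    using assms by (auto simp: uniform_hypergraph_def contains_berge_def)
  then have "?S \<noteq> {}" by blast
  ultimately have "ex_berge r n V E \<in> ?S" unfolding ex_berge_def by (rule Max_in)
  then show thesis using that by auto
qed

theorem theorem4:
  fixes V :: "'a set" and E :: "'a set set" and e :: "'a set"
  assumes "graph V E" and "e \<in> E"
  shows "uniformity_threshold V E
           \<le> ramsey_number {0..<chromatic_number V E} (complete_graph_edges (chromatic_number V E))
                            V (E - {e})"
  unfolding uniformity_threshold_def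
proof (intro Least_le allI impI landau_o.smallI)
  fix r and \<epsilon> :: real
  assume "ramsey_number {0..<chromatic_number V E} (complete_graph_edges (chromatic_number V E))
      V (E - {e}) \<le> r" and "0 < \<epsilon>"
  then have "\<forall>\<^sub>F n in sequentially. \<forall>H. uniform_hypergraph r n H \<and> \<not> contains_berge V E n H \<longrightarrow>
      card H \<le> \<epsilon> * (real n)\<^sup>2"
    by (intro eventually_berge_free_card_le[OF assms])
  then show "\<forall>\<^sub>F n in sequentially. norm (real (ex_berge r n V E)) \<le> \<epsilon> * norm (real n ^ 2)"
  proof (rule eventually_mono)
    fix n
    assume sparse: "\<forall>H. uniform_hypergraph r n H \<and> \<not> contains_berge V E n H \<longrightarrow>
        card H \<le> \<epsilon> * (real n)\<^sup>2"
    obtain H where "uniform_hypergraph r n H" "\<not> contains_berge V E n H" "card H = ex_berge r n V E"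
      using ex_berge_attained assms(2) by blast
    then show "norm (real (ex_berge r n V E)) \<le> \<epsilon> * norm (real n ^ 2)"
      using sparse by force
  qed
qed

end
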